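(* Let $\mu>0$, $\gamma>0$, and let $f:\mathbb{R}\to[0,\infty)$ be a non-negative piecewise continuous function with $\int^\infty f(y)\,dy<\infty$. Define $$\Psi_\gamma(x):=\mathbf{E}_x\Bigl(\exp\Bigl(-\gamma\int_0^\infty f(B^{(\mu)}_s)\,ds\Bigr)\Bigr),\qquad x\in\mathbb{R}.$$ Then $x\mapsto\Psi_\gamma(x)$ is the unique positive, non-decreasing and continuously differentiable solution of the problem $$\frac12 v''(x)+\mu v'(x)-\gamma f(x)v(x)=0,\qquad \lim_{x\to\infty}v(x)=1.$$
   Context: $B^{(\mu)}$ is a Brownian motion with drift $\mu$, and $\mathbf{E}_x$ denotes expectation when it is started from $x$, i.e. $B^{(\mu)}_t=x+B_t+\mu t$ with $B$ a standard Brownian motion started from $0$. The notation $\int^\infty f(y)\,dy<\infty$ means that $f$ is integrable on a neighbourhood of $+\infty$. The differential equation is understood to hold on the intervals of continuity of $f$; at points of discontinuity of $f$ the solution is required to be continuously differentiable but need not be twice differentiable. *)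

theory Defs
  imports "HOL-Probability.Probability"
begin

text \<open>
  Standard one-dimensional Brownian motion started from 0. Times are reals, of which only
  \<open>t \<ge> 0\<close> are constrained. All paths (not just almost all) are continuous on
  \<open>[0, \<infinity>)\<close>, so that path functionals are measurable without completing \<open>M\<close>.
\<close>

locale standard_brownian_motion = prob_space M
  for M :: "'a measure" and B :: "real \<Rightarrow> 'a \<Rightarrow> real" +
  assumes measurable_B: "t \<ge> 0 \<Longrightarrow> B t \<in> borel_measurable M"
    and start: "AE \<omega> in M. B 0 \<omega> = 0"
    and continuous_paths: "\<omega> \<in> space M \<Longrightarrow> continuous_on {0..} (\<lambda>t. B t \<omega>)"
    and normal_increments: "0 \<le> s \<Longrightarrow> s < t \<Longrightarrow>
      distributed M lborel (\<lambda>\<omega>. B t \<omega> - B s \<omega>) (normal_density 0 (sqrt (t - s)))"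
    and independent_increments: "0 \<le> \<tau> 0 \<Longrightarrow> strict_mono_on {..n} \<tau> \<Longrightarrow>
      indep_vars (\<lambda>_. borel) (\<lambda>i \<omega>. B (\<tau> (Suc i)) \<omega> - B (\<tau> i) \<omega>) {..<(n::nat)}"

definition brownian_with_drift ::
    "(real \<Rightarrow> 'a \<Rightarrow> real) \<Rightarrow> real \<Rightarrow> real \<Rightarrow> real \<Rightarrow> 'a \<Rightarrow> real" where
  "brownian_with_drift B \<mu> x t \<omega> = x + B t \<omega> + \<mu> * t"

text \<open>
  The perpetual integral takes values in \<open>[0, \<infinity>]\<close>, with \<open>exp (-\<infinity>) = 0\<close>.
\<close>

definition exp_neg :: "ennreal \<Rightarrow> real" where
  "exp_neg a = (if a = \<infinity> then 0 else exp (- enn2real a))"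

definition perpetual_integral ::
    "(real \<Rightarrow> 'a \<Rightarrow> real) \<Rightarrow> real \<Rightarrow> (real \<Rightarrow> real) \<Rightarrow> real \<Rightarrow> 'a \<Rightarrow> ennreal" where
  "perpetual_integral B \<mu> f x \<omega> =
    (\<integral>\<^sup>+s\<in>{0..}. ennreal (f (brownian_with_drift B \<mu> x s \<omega>)) \<partial>lborel)"

definition Psi ::
    "'a measure \<Rightarrow> (real \<Rightarrow> 'a \<Rightarrow> real) \<Rightarrow> real \<Rightarrow> real \<Rightarrow> (real \<Rightarrow> real) \<Rightarrow> real \<Rightarrow> real" where
  "Psi M B \<mu> \<gamma> f x =
    integral\<^sup>L M (\<lambda>\<omega>. exp_neg (ennreal \<gamma> * perpetual_integral B \<mu> f x \<omega>))"

text \<open>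
  Finitely many discontinuities in each bounded interval, and finite one-sided limits
  everywhere; the value at a discontinuity is arbitrary.
\<close>

definition piecewise_continuous :: "(real \<Rightarrow> real) \<Rightarrow> bool" where
  "piecewise_continuous f \<longleftrightarrow>
    (\<forall>a b. finite {x \<in> {a..b}. \<not> isCont f x}) \<and>
    (\<forall>x. \<exists>l. (f \<longlongrightarrow> l) (at_left x)) \<and>
    (\<forall>x. \<exists>l. (f \<longlongrightarrow> l) (at_right x))"

definition integrable_near_infinity :: "(real \<Rightarrow> real) \<Rightarrow> bool" where
  "integrable_near_infinity f \<longleftrightarrow> (\<exists>a. set_integrable lborel {a..} f)"

text \<open>
  The differential equation is imposed only where \<open>f\<close> is continuous; elsewhere only the
  first derivative of \<open>v\<close> is required to exist and be continuous.
\<close>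

definition solves_problem :: "real \<Rightarrow> real \<Rightarrow> (real \<Rightarrow> real) \<Rightarrow> (real \<Rightarrow> real) \<Rightarrow> bool" where
  "solves_problem \<mu> \<gamma> f v \<longleftrightarrow>
    v C1_differentiable_on UNIV \<and>
    (\<forall>x. isCont f x \<longrightarrow>
      deriv v field_differentiable at x \<and>
      1 / 2 * deriv (deriv v) x + \<mu> * deriv v x - \<gamma> * f x * v x = 0) \<and>
    (v \<longlongrightarrow> 1) at_top"

end

theory Submission
  imports Defs "HOL-Real_Asymp.Real_Asymp"
begin

text \<open>
  No stochastic calculus is used. Pathwise
  \<open>1 - exp (- \<gamma> \<integral>\<^sub>0 f (X\<^sub>t) dt) = \<integral>\<^sub>0 \<gamma> f (X\<^sub>s) exp (- \<gamma> \<integral>\<^sub>s f (X\<^sub>t) dt) ds\<close>,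
  so the Markov property at fixed times and the Green function
  \<open>g (z) = exp (2 \<mu> min z 0) / \<mu>\<close> of Brownian motion with drift give
  \<open>1 - \<Psi> (x) = \<integral> g (y - x) \<gamma> f (y) \<Psi> (y) dy\<close>, provided that the perpetual integral is
  almost surely finite. Writing \<open>g\<close> itself as an integral turns this into
  \<open>1 - \<Psi> (x) = \<integral>\<^sub>x 2 exp (- 2 \<mu> t) K (t) dt\<close> with
  \<open>K (t) = \<integral> exp (2 \<mu> y) \<gamma> f (y) \<Psi> (y) dy\<close> over \<open>y \<le> t\<close>, from which the differential
  equation, monotonicity and the limit can be read off.

  Finiteness is obtained from the same identity. For \<open>f\<close> cut off near \<open>-\<infinity>\<close> the expected
  perpetual integral is finite; the resulting lower bound on \<open>\<Psi>\<close> does not depend on the cut-off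
  and shows \<open>\<Psi> (x) \<longrightarrow> 1\<close> as \<open>x \<longrightarrow> \<infinity>\<close>. The perpetual integral is finite if its
  tail after \<open>s\<close> is, which has probability at least \<open>E \<Psi> (X\<^sub>s) \<longrightarrow> 1\<close>.

  For uniqueness, if \<open>d\<close> is the difference of two solutions then \<open>exp (2 \<mu> x) d d'\<close> is
  nondecreasing and tends to \<open>0\<close> at \<open>-\<infinity>\<close>, so \<open>d\<^sup>2\<close> is nondecreasing with limit \<open>0\<close>
  at \<open>\<infinity>\<close>.
\<close>

section \<open>Uniqueness for the differential equation\<close>

text \<open>The differential equation holds only where \<open>f\<close> is continuous. A bounded
  interval contains finitely many other points, and continuity of \<open>g\<close> across them keeps
  the fundamental theorem of calculus valid.\<close>

lemma nondecreasing_except_finite: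
  fixes g g' :: "real \<Rightarrow> real"
  assumes "a \<le> b" "finite S" "continuous_on {a..b} g"
    and deriv: "\<And>x. x \<in> {a..b} - S \<Longrightarrow> (g has_real_derivative g' x) (at x)"
    and nonneg: "\<And>x. x \<in> {a..b} - S \<Longrightarrow> 0 \<le> g' x"
  shows "g a \<le> g b"
proof -
  let ?h = "\<lambda>x. if x \<in> S then 0 else g' x"
  have "(?h has_integral (g b - g a)) {a..b}"
    using assms by (intro fundamental_theorem_of_calculus_strong[OF \<open>finite S\<close> \<open>a \<le> b\<close>])
      (auto simp: has_real_derivative_iff_has_vector_derivative)
  then have "0 \<le> g b - g a"
    by (rule has_integral_nonneg) (use nonneg in auto)
  then show ?thesis by simp
qed

text \<open>The integrating factor \<open>exp (2 * \<mu> * x)\<close> absorbs the first-order term.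
  In this form the derivative of the weighted \<open>deriv v\<close> has the sign of
  \<open>v\<close>, which drives the whole uniqueness argument.\<close>

lemma solution_derivs:
  assumes "solves_problem \<mu> \<gamma> f v"
  shows "(v has_real_derivative deriv v x) (at x)"
    and "continuous_on UNIV (deriv v)"
    and "isCont f x \<Longrightarrow> ((\<lambda>x. exp (2 * \<mu> * x) * deriv v x) has_real_derivative
           2 * \<gamma> * f x * v x * exp (2 * \<mu> * x)) (at x)"
proof -
  have v: "v differentiable at x" "continuous_on UNIV (\<lambda>x. vector_derivative v (at x))" for x
    using assms by (auto simp: solves_problem_def C1_differentiable_on_eq)
  show D: "(v has_real_derivative deriv v x) (at x)" for x
    using v(1)[of x] by (metis DERIV_imp_deriv differentiable_def has_real_derivative)
  have "vector_derivative v (at x) = deriv v x" for x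
    using D[of x] by (simp add: has_real_derivative_iff_has_vector_derivative vector_derivative_at)
  then show "continuous_on UNIV (deriv v)"
    using v(2) by simp
  assume "isCont f x"
  then have *: "deriv v field_differentiable at x"
      "1 / 2 * deriv (deriv v) x + \<mu> * deriv v x - \<gamma> * f x * v x = 0"
    using assms by (auto simp: solves_problem_def)
  from *(1) have "(deriv v has_real_derivative deriv (deriv v) x) (at x)"
    using DERIV_deriv_iff_field_differentiable by blast
  moreover have "deriv (deriv v) x = 2 * \<gamma> * f x * v x - 2 * \<mu> * deriv v x"
    using *(2) by (simp add: field_simps)
  ultimately show "((\<lambda>x. exp (2 * \<mu> * x) * deriv v x) has_real_derivative
           2 * \<gamma> * f x * v x * exp (2 * \<mu> * x)) (at x)"
    by (auto intro!: derivative_eq_intros simp: algebra_simps)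
qed

locale drift_equation =
  fixes \<mu> \<gamma> :: real and f :: "real \<Rightarrow> real"
  assumes \<mu>: "0 < \<mu>" and \<gamma>: "0 < \<gamma>" and f_nonneg: "\<And>x. 0 \<le> f x"
    and pc: "piecewise_continuous f"
begin

lemma finite_discontinuities: "finite {x \<in> {a..b}. \<not> isCont f x}"
  using pc by (simp add: piecewise_continuous_def)

definition admissible :: "(real \<Rightarrow> real) \<Rightarrow> bool" where
  "admissible v \<longleftrightarrow> (\<forall>x. 0 < v x) \<and> mono v \<and> solves_problem \<mu> \<gamma> f v"

lemma admissible_le_1:
  assumes "admissible v" shows "v x \<le> 1"
proof (rule tendsto_lowerbound)
  show "(v \<longlongrightarrow> 1) at_top" using assms by (simp add: admissible_def solves_problem_def)
  show "eventually (\<lambda>y. v x \<le> v y) at_top"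
    using assms by (intro eventually_mono[OF eventually_ge_at_top[of x]]) (auto simp: admissible_def mono_def)
qed auto

lemma weighted_deriv_nonneg:
  assumes "admissible v" shows "0 \<le> exp (2 * \<mu> * x) * deriv v x"
proof -
  have "0 \<le> deriv v x"
    using assms solution_derivs(1)[of \<mu> \<gamma> f v x]
    by (intro mono_on_imp_deriv_nonneg[of UNIV v]) (auto simp: admissible_def)
  then show ?thesis by simp
qed

lemma weighted_deriv_mono:
  assumes "admissible v" "x \<le> y"
  shows "exp (2 * \<mu> * x) * deriv v x \<le> exp (2 * \<mu> * y) * deriv v y"
proof (rule nondecreasing_except_finite[OF \<open>x \<le> y\<close> finite_discontinuities[of x y],
      where g'="\<lambda>t. 2 * \<gamma> * f t * v t * exp (2 * \<mu> * t)"])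
  have sol: "solves_problem \<mu> \<gamma> f v" and pos: "\<And>x. 0 < v x"
    using assms by (auto simp: admissible_def)
  show "continuous_on {x..y} (\<lambda>x. exp (2 * \<mu> * x) * deriv v x)"
    by (intro continuous_intros continuous_on_subset[OF solution_derivs(2)[OF sol]]) auto
  show "((\<lambda>x. exp (2 * \<mu> * x) * deriv v x) has_real_derivative
           2 * \<gamma> * f t * v t * exp (2 * \<mu> * t)) (at t)"
    if "t \<in> {x..y} - {z \<in> {x..y}. \<not> isCont f z}" for t
    using that by (intro solution_derivs(3)[OF sol]) auto
  show "0 \<le> 2 * \<gamma> * f t * v t * exp (2 * \<mu> * t)" for t
    using \<gamma> f_nonneg[of t] pos[of t] by simp
qed

text \<open>A positive lower bound \<open>c\<close> on the weighted derivative would make \<open>v\<close> fall below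
  \<open>v 0 - c \<bar>x\<bar>\<close> on the negative half-line, hence below 0.\<close>

lemma weighted_deriv_small:
  assumes v: "admissible v" and "0 < c"
  shows "\<exists>a. \<forall>x\<le>a. exp (2 * \<mu> * x) * deriv v x < c"
proof (rule ccontr)
  assume *: "\<not> ?thesis"
  have ge: "c \<le> exp (2 * \<mu> * x) * deriv v x" for x
  proof -
    from * obtain y where "y \<le> x" "c \<le> exp (2 * \<mu> * y) * deriv v y"
      by (meson not_less)
    then show ?thesis using weighted_deriv_mono[OF v, of y x] by simp
  qed
  have sol: "solves_problem \<mu> \<gamma> f v" and pos: "\<And>x. 0 < v x"
    using v by (auto simp: admissible_def)
  have "c \<le> deriv v x" if "x \<le> 0" for x
  proof -
    have "exp (2 * \<mu> * x) * deriv v x \<le> 1 * deriv v x"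
      using weighted_deriv_nonneg[OF v, of x] that \<mu>
      by (intro mult_right_mono) (auto simp: zero_le_mult_iff mult_nonneg_nonpos)
    then show ?thesis using ge[of x] by simp
  qed
  \<comment> \<open>The point where the line \<open>v 0 + c * x\<close>, which dominates
    \<open>v\<close> on the negative half-line, reaches 0.\<close>
  moreover define x where "x = - (v 0 / c)"
  ultimately have "v x - c * x \<le> v 0 - c * 0"
    using pos[of 0] \<open>0 < c\<close> solution_derivs(1)[OF sol]
    by (intro DERIV_nonneg_imp_nondecreasing[of x 0 "\<lambda>x. v x - c * x"])
       (auto intro!: derivative_eq_intros exI simp: x_def)
  then show False using pos[of x] \<open>0 < c\<close> by (simp add: x_def)
qed

lemma admissible_unique:
  assumes v: "admissible v" and u: "admissible u"
  shows "v = u"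
proof
  define d where "d x = v x - u x" for x
  define d' where "d' x = deriv v x - deriv u x" for x
  have sol: "solves_problem \<mu> \<gamma> f v" "solves_problem \<mu> \<gamma> f u"
    using u v by (auto simp: admissible_def)
  have d: "(d has_real_derivative d' x) (at x)" for x
    unfolding d_def d'_def using solution_derivs(1)[OF sol(1)] solution_derivs(1)[OF sol(2)]
    by (intro derivative_intros)
  have contd: "continuous_on A d" for A
    using d by (meson DERIV_isCont continuous_at_imp_continuous_on)
  have contd': "continuous_on A d'" for A
    unfolding d'_def using continuous_on_subset[OF solution_derivs(2)[OF sol(1)]] continuous_on_subset[OF solution_derivs(2)[OF sol(2)]]
    by (intro continuous_intros) auto
  have bound: "\<bar>d x\<bar> \<le> 1" for x
    using admissible_le_1[OF v, of x] admissible_le_1[OF u, of x] u v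
    unfolding admissible_def d_def by (smt (verit))
  define \<phi> where "\<phi> x = (exp (2 * \<mu> * x) * d' x) * d x" for x
  \<comment> \<open>\<open>\<phi>\<close> is half the weighted derivative of \<open>d\<close>
    squared. Differentiating it yields nonnegative multiples of \<open>d\<close> squared and
    \<open>d'\<close> squared, whatever the sign of \<open>d\<close>.\<close>
  have \<phi>_mono: "\<phi> x \<le> \<phi> y" if "x \<le> y" for x y
  proof (rule nondecreasing_except_finite[OF that finite_discontinuities[of x y],
        where g'="\<lambda>t. 2 * \<gamma> * f t * d t * exp (2 * \<mu> * t) * d t + d' t * (exp (2 * \<mu> * t) * d' t)"])
    show "continuous_on {x..y} \<phi>"
      unfolding \<phi>_def by (intro continuous_intros contd contd')
    fix t assume "t \<in> {x..y} - {z \<in> {x..y}. \<not> isCont f z}"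
    then have t: "isCont f t" by auto
    have "((\<lambda>x. exp (2 * \<mu> * x) * d' x) has_real_derivative
        2 * \<gamma> * f t * d t * exp (2 * \<mu> * t)) (at t)"
      using DERIV_diff[OF solution_derivs(3)[OF sol(1) t] solution_derivs(3)[OF sol(2) t]]
      by (simp add: d'_def d_def algebra_simps)
    then show "(\<phi> has_real_derivative 2 * \<gamma> * f t * d t * exp (2 * \<mu> * t) * d t
        + d' t * (exp (2 * \<mu> * t) * d' t)) (at t)"
      unfolding \<phi>_def by (rule DERIV_mult[OF _ d])
    have "0 \<le> 2 * \<gamma> * f t * exp (2 * \<mu> * t) * (d t)\<^sup>2" "0 \<le> exp (2 * \<mu> * t) * (d' t)\<^sup>2"
      using \<gamma> f_nonneg[of t] by auto
    then show "0 \<le> 2 * \<gamma> * f t * d t * exp (2 * \<mu> * t) * d t + d' t * (exp (2 * \<mu> * t) * d' t)"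
      by (simp only: power2_eq_square mult_ac add_nonneg_nonneg)
  qed
  \<comment> \<open>Far to the left both weighted derivatives lie between 0 and \<open>e\<close>,
    hence so does the absolute value of their difference, while \<open>d\<close> is bounded by 1. So
    \<open>\<phi> y\<close> is at least \<open>- e\<close> there, and monotonicity carries this
    bound to \<open>x\<close>.\<close>
  have \<phi>_nonneg: "0 \<le> \<phi> x" for x
  proof (rule field_le_epsilon)
    fix e :: real assume "0 < e"
    obtain a b where ab: "\<forall>x\<le>a. exp (2 * \<mu> * x) * deriv v x < e" "\<forall>x\<le>b. exp (2 * \<mu> * x) * deriv u x < e"
      using weighted_deriv_small[OF v \<open>0 < e\<close>] weighted_deriv_small[OF u \<open>0 < e\<close>] by auto
    define y where "y = min x (min a b)"
    have "\<bar>exp (2 * \<mu> * y) * d' y\<bar> \<le> e"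
    proof -
      have "y \<le> a" "y \<le> b" by (auto simp: y_def)
      then have "exp (2 * \<mu> * y) * deriv v y < e" "exp (2 * \<mu> * y) * deriv u y < e"
        using ab by blast+
      moreover note weighted_deriv_nonneg[OF v, of y] weighted_deriv_nonneg[OF u, of y]
      ultimately show ?thesis
        unfolding d'_def right_diff_distrib by linarith
    qed
    then have "\<bar>\<phi> y\<bar> \<le> e * 1"
      unfolding \<phi>_def abs_mult[of _ "d y"] using bound[of y] \<open>0 < e\<close> by (intro mult_mono) auto
    moreover have "\<phi> y \<le> \<phi> x" by (rule \<phi>_mono) (simp add: y_def)
    ultimately show "0 \<le> \<phi> x + e" by linarith
  qed
  fix x
  have "(d x)\<^sup>2 \<le> 0"
  proof (rule tendsto_lowerbound)
    show "((\<lambda>y. (d y)\<^sup>2) \<longlongrightarrow> 0) at_top"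
      using tendsto_power[OF tendsto_diff[of v 1 at_top u 1], of 2] sol
      by (auto simp: solves_problem_def d_def)
    show "eventually (\<lambda>y. (d x)\<^sup>2 \<le> (d y)\<^sup>2) at_top"
      using eventually_ge_at_top[of x]
    proof eventually_elim
      fix y assume "x \<le> y"
      then show "(d x)\<^sup>2 \<le> (d y)\<^sup>2"
      proof (rule DERIV_nonneg_imp_nondecreasing)
        fix t
        have "((\<lambda>y. (d y)\<^sup>2) has_real_derivative 2 * (d t * d' t)) (at t)"
          by (auto intro!: derivative_eq_intros d)
        moreover have "0 \<le> d t * d' t"
          using \<phi>_nonneg[of t] by (auto simp: \<phi>_def zero_le_mult_iff mult_le_0_iff)
        ultimately show "\<exists>y. ((\<lambda>y. (d y)\<^sup>2) has_real_derivative y) (at t) \<and> 0 \<le> y"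
          by auto
      qed
    qed
  qed auto
  then show "v x = u x" by (simp add: d_def)
qed

end

section \<open>The Green function\<close>

abbreviation normal_cdf :: "real \<Rightarrow> real" where
  "normal_cdf \<equiv> cdf std_normal_distribution"

interpretation std_normal: real_distribution std_normal_distribution
  by (rule real_dist_normal_dist)

lemma DERIV_normal_cdf: "(normal_cdf has_real_derivative std_normal_density x) (at x)"
proof -
  have cont: "continuous_on {x - 1..x + 1} std_normal_density"
    unfolding std_normal_density_def by (intro continuous_intros) auto
  have int: "normal_cdf u = normal_cdf (x - 1) + integral {x - 1..u} std_normal_density"
    if "x - 1 \<le> u" for u
  proof (cases "x - 1 = u")
    case False
    then have "x - 1 < u" using that by auto
    have si: "set_integrable lborel {x - 1<..u} std_normal_density"
      using integrable_normal_density[of 1 0] unfolding set_integrable_def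
      by (intro integrable_mult_indicator) auto
    have "normal_cdf u - normal_cdf (x - 1) = measure std_normal_distribution {x - 1<..u}"
      using \<open>x - 1 < u\<close> by (rule std_normal.cdf_diff_eq)
    also have "\<dots> = (LINT t:{x - 1<..u}|lborel. std_normal_density t)"
    proof -
      have "emeasure std_normal_distribution {x - 1<..u} =
          (\<integral>\<^sup>+t. ennreal (indicator {x - 1<..u} t *\<^sub>R std_normal_density t) \<partial>lborel)"
        by (subst emeasure_density) (auto intro!: nn_integral_cong simp: indicator_def)
      also have "\<dots> = ennreal (LINT t:{x - 1<..u}|lborel. std_normal_density t)"
        using si unfolding set_integrable_def set_lebesgue_integral_def
        by (intro nn_integral_eq_integral) (auto simp: indicator_def)
      finally show ?thesis
        by (simp add: measure_def set_lebesgue_integral_def integral_nonneg_AE)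
    qed
    also have "\<dots> = integral {x - 1<..u} std_normal_density"
      using si by (rule set_borel_integral_eq_integral)
    also have "\<dots> = integral {x - 1..u} std_normal_density"
      by (rule integral_subset_negligible)
         (auto intro: negligible_subset[of "{x - 1}"])
    finally show ?thesis by simp
  qed (use that in auto)
  have "((\<lambda>u. integral {x - 1..u} std_normal_density) has_real_derivative std_normal_density x) (at x within {x - 1..x + 1})"
    by (rule integral_has_real_derivative[OF cont]) auto
  then have "((\<lambda>u. normal_cdf (x - 1) + integral {x - 1..u} std_normal_density) has_real_derivative std_normal_density x) (at x within {x - 1..x + 1})"
    by (auto intro!: derivative_eq_intros)
  then have "(normal_cdf has_real_derivative std_normal_density x) (at x within {x - 1..x + 1})"
    by (rule has_field_derivative_transform_within[where d=1]) (auto simp: dist_real_def intro!: int[symmetric])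
  then show ?thesis
    by (simp add: at_within_Icc_at)
qed

text \<open>The antiderivative in time of the transition density comes from the distribution function of
  the inverse Gaussian law.\<close>

lemma nn_integral_normal_density_time:
  fixes \<mu> z :: real
  assumes "0 < \<mu>" "z \<noteq> 0"
  shows "(\<integral>\<^sup>+s\<in>{0<..}. normal_density (\<mu> * s) (sqrt s) z \<partial>lborel) =
    ennreal ((if z < 0 then exp (2 * \<mu> * z) else 1) / \<mu>)"
proof -
  define a where "a s = (\<mu> * s - z) / sqrt s" for s
  define b where "b s = (- \<mu> * s - z) / sqrt s" for s
  \<comment> \<open>For \<open>z > 0\<close>, a plus sign in place of the minus, without the factor
    \<open>1 / \<mu>\<close>, would give the distribution function of the first passage time to
    \<open>z\<close>. The minus sign produces an antiderivative of the transition density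
    instead.\<close>
  define F where "F s = (normal_cdf (a s) - exp (2 * \<mu> * z) * normal_cdf (b s)) / \<mu>" for s
  define p where "p s = normal_density (\<mu> * s) (sqrt s) z" for s
  have F: "(F has_real_derivative p s) (at s)" if "0 < s" for s
  proof -
    have da: "(a has_real_derivative (\<mu> + z / s) / (2 * sqrt s)) (at s)"
      unfolding a_def using that
      by (auto intro!: derivative_eq_intros simp: field_simps)
    have db: "(b has_real_derivative (- \<mu> + z / s) / (2 * sqrt s)) (at s)"
      unfolding b_def using that
      by (auto intro!: derivative_eq_intros simp: field_simps)
    have sq: "(a s)\<^sup>2 = (z - \<mu> * s)\<^sup>2 / s" "(b s)\<^sup>2 = (a s)\<^sup>2 + 4 * \<mu> * z"
      using that by (auto simp: a_def b_def power_divide field_simps power2_eq_square)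
    \<comment> \<open>Both Gaussian terms in the derivative of \<open>F\<close> thus carry the same
      factor. The \<open>z / s\<close> parts of the inner derivatives cancel and the
      \<open>\<mu>\<close> parts add up.\<close>
    have ab: "exp (2 * \<mu> * z) * std_normal_density (b s) = std_normal_density (a s)"
      unfolding std_normal_density_def sq(2) by (simp add: field_simps flip: exp_add)
    have pa: "p s = std_normal_density (a s) / sqrt s"
      unfolding p_def normal_density_def std_normal_density_def using that
      by (simp add: sq real_sqrt_mult field_simps)
    have "(F has_real_derivative (std_normal_density (a s) * ((\<mu> + z / s) / (2 * sqrt s)) -
       exp (2 * \<mu> * z) * (std_normal_density (b s) * ((- \<mu> + z / s) / (2 * sqrt s)))) / \<mu>) (at s)"
      unfolding F_def
      by (intro derivative_intros DERIV_cdivide DERIV_diff DERIV_cmult DERIV_chain2[OF DERIV_normal_cdf] da db)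
    also have "(std_normal_density (a s) * ((\<mu> + z / s) / (2 * sqrt s)) -
       exp (2 * \<mu> * z) * (std_normal_density (b s) * ((- \<mu> + z / s) / (2 * sqrt s)))) / \<mu> = p s"
      unfolding pa mult.assoc[symmetric] ab using assms that by (simp add: field_simps)
    finally show ?thesis .
  qed
  have top: "(F \<longlongrightarrow> 1 / \<mu>) at_top"
  proof -
    have "filterlim a at_top at_top" "filterlim b at_bot at_top"
      unfolding a_def b_def using assms(1) by real_asymp+
    then have "((\<lambda>s. normal_cdf (a s)) \<longlongrightarrow> 1) at_top" "((\<lambda>s. normal_cdf (b s)) \<longlongrightarrow> 0) at_top"
      using filterlim_compose[OF std_normal.cdf_lim_at_top_prob] filterlim_compose[OF std_normal.cdf_lim_at_bot]
      by blast+
    then have "(F \<longlongrightarrow> (1 - exp (2 * \<mu> * z) * 0) / \<mu>) at_top"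
      unfolding F_def by (intro tendsto_intros) (use assms in auto)
    then show ?thesis by simp
  qed
  \<comment> \<open>The limit of \<open>F\<close> at time 0. For \<open>z < 0\<close> both arguments
    \<open>a\<close> and \<open>b\<close> tend to plus infinity, for \<open>z > 0\<close> both tend
    to minus infinity.\<close>
  define c where "c = (if z < 0 then 1 - exp (2 * \<mu> * z) else 0) / \<mu>"
  have bot: "(F \<longlongrightarrow> c) (at_right 0)"
  proof (cases "z < 0")
    case True
    then have "filterlim a at_top (at_right 0)" "filterlim b at_top (at_right 0)"
      unfolding a_def b_def using assms(1) by real_asymp+
    then have "((\<lambda>s. normal_cdf (a s)) \<longlongrightarrow> 1) (at_right 0)" "((\<lambda>s. normal_cdf (b s)) \<longlongrightarrow> 1) (at_right 0)"
      using filterlim_compose[OF std_normal.cdf_lim_at_top_prob] by blast+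
    then have "(F \<longlongrightarrow> (1 - exp (2 * \<mu> * z) * 1) / \<mu>) (at_right 0)"
      unfolding F_def by (intro tendsto_intros) (use assms in auto)
    then show ?thesis using True by (simp add: c_def)
  next
    case False
    then have "z > 0" using assms by auto
    then have "filterlim a at_bot (at_right 0)" "filterlim b at_bot (at_right 0)"
      unfolding a_def b_def using assms(1) by real_asymp+
    then have "((\<lambda>s. normal_cdf (a s)) \<longlongrightarrow> 0) (at_right 0)" "((\<lambda>s. normal_cdf (b s)) \<longlongrightarrow> 0) (at_right 0)"
      using filterlim_compose[OF std_normal.cdf_lim_at_bot] by blast+
    then have "(F \<longlongrightarrow> (0 - exp (2 * \<mu> * z) * 0) / \<mu>) (at_right 0)"
      unfolding F_def by (intro tendsto_intros) (use assms in auto)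
    then show ?thesis using False by (simp add: c_def)
  qed
  have cont: "isCont p s" if "0 < s" for s
    unfolding p_def normal_density_def using that by (intro continuous_intros) auto
  have p_nonneg: "0 \<le> p s" for s by (simp add: p_def)
  have A: "((F \<circ> real_of_ereal) \<longlongrightarrow> c) (at_right (ereal 0))"
    using bot by (simp add: ereal_tendsto_simps)
  have B: "((F \<circ> real_of_ereal) \<longlongrightarrow> 1 / \<mu>) (at_left \<infinity>)"
    using top by (simp add: ereal_tendsto_simps)
  have "set_integrable lborel (einterval (ereal 0) \<infinity>) p" "(LBINT x=ereal 0..\<infinity>. p x) = 1 / \<mu> - c"
    by (rule interval_integral_FTC_nonneg[where F=F, OF _ _ _ _ A B]; use F cont p_nonneg in auto)+
  then have si: "set_integrable lborel {0<..} p" and li: "(LINT x:{0<..}|lborel. p x) = 1 / \<mu> - c"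
    by (auto simp: interval_lebesgue_integral_def einterval_def greaterThan_def zero_ereal_def)
  have "(\<integral>\<^sup>+s\<in>{0<..}. p s \<partial>lborel) = (\<integral>\<^sup>+s. ennreal (indicator {0<..} s *\<^sub>R p s) \<partial>lborel)"
    by (intro nn_integral_cong) (auto simp: indicator_def)
  also have "\<dots> = ennreal (LINT x:{0<..}|lborel. p x)"
    using si p_nonneg unfolding set_integrable_def set_lebesgue_integral_def
    by (intro nn_integral_eq_integral) (auto simp: indicator_def)
  also note li
  also have "1 / \<mu> - c = (if z < 0 then exp (2 * \<mu> * z) else 1) / \<mu>"
    by (auto simp: c_def diff_divide_distrib)
  finally show ?thesis by (simp add: p_def)
qed

section \<open>The Markov property\<close>

abbreviation path_space :: "(real \<Rightarrow> real) measure" where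
  "path_space \<equiv> PiM {0..} (\<lambda>_. borel)"

text \<open>Subtracting \<open>B s\<close> makes the law of the path independent of
  \<open>s\<close>. The restriction to \<open>{0..}\<close> makes it a point of
  \<open>path_space\<close>, whose elements are undefined outside the index set.\<close>

definition increment_path :: "(real \<Rightarrow> 'a \<Rightarrow> real) \<Rightarrow> real \<Rightarrow> 'a \<Rightarrow> real \<Rightarrow> real" where
  "increment_path B s \<omega> = (\<lambda>t\<in>{0..}. B (s + t) \<omega> - B s \<omega>)"

lemma sum_increments:
  fixes g :: "nat \<Rightarrow> real"
  shows "(\<Sum>j<i. g (Suc j) - g j) = g i - g 0"
  by (induction i) auto

context standard_brownian_motion
begin

lemma measurable_B'[measurable]: "0 \<le> t \<Longrightarrow> random_variable borel (B t)"
  by (rule measurable_B)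

lemma measurable_increment_path:
  "0 \<le> s \<Longrightarrow> increment_path B s \<in> M \<rightarrow>\<^sub>M path_space"
  unfolding increment_path_def
  by (intro measurable_restrict borel_measurable_diff measurable_B) auto

lemma distr_increment:
  assumes "0 \<le> s" "s < t"
  shows "distr M borel (\<lambda>\<omega>. B t \<omega> - B s \<omega>) = density lborel (normal_density 0 (sqrt (t - s)))"
proof -
  have "distr M borel (\<lambda>\<omega>. B t \<omega> - B s \<omega>) = distr M lborel (\<lambda>\<omega>. B t \<omega> - B s \<omega>)"
    by (intro distr_cong) auto
  also have "\<dots> = density lborel (normal_density 0 (sqrt (t - s)))"
    using normal_increments[OF assms] by (rule distributed_distr_eq_density)
  finally show ?thesis .
qed

text \<open>Independence turns the joint law into the product of the marginals, and each marginal
  depends on a time difference only. The right-hand side is free of \<open>s\<close>: this is the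
  stationarity used in the Markov property.\<close>

lemma distr_increments:
  assumes "0 \<le> s" "0 < n" and \<tau>: "\<tau> 0 = 0" "strict_mono_on {..n} \<tau>"
  shows "distr M (\<Pi>\<^sub>M i\<in>{..<n}. borel) (\<lambda>\<omega>. \<lambda>i\<in>{..<n}. B (s + \<tau> (Suc i)) \<omega> - B (s + \<tau> i) \<omega>)
    = (\<Pi>\<^sub>M i\<in>{..<n}. density lborel (normal_density 0 (sqrt (\<tau> (Suc i) - \<tau> i))))"
proof -
  have nn: "0 \<le> \<tau> i" if "i \<le> n" for i
    using strict_mono_on_leD[OF \<tau>(2), of 0 i] that \<tau>(1) by auto
  have "indep_vars (\<lambda>_. borel) (\<lambda>i \<omega>. B (s + \<tau> (Suc i)) \<omega> - B (s + \<tau> i) \<omega>) {..<n}"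
    by (rule independent_increments) (use assms in \<open>auto simp: strict_mono_on_def\<close>)
  then have "distr M (\<Pi>\<^sub>M i\<in>{..<n}. borel) (\<lambda>\<omega>. \<lambda>i\<in>{..<n}. B (s + \<tau> (Suc i)) \<omega> - B (s + \<tau> i) \<omega>)
    = (\<Pi>\<^sub>M i\<in>{..<n}. distr M borel (\<lambda>\<omega>. B (s + \<tau> (Suc i)) \<omega> - B (s + \<tau> i) \<omega>))"
    by (subst (asm) indep_vars_iff_distr_eq_PiM')
      (use assms nn in \<open>auto intro!: borel_measurable_diff measurable_B\<close>)
  also have "\<dots> = (\<Pi>\<^sub>M i\<in>{..<n}. density lborel (normal_density 0 (sqrt (\<tau> (Suc i) - \<tau> i))))"
  proof (rule PiM_cong)
    fix i assume "i \<in> {..<n}"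
    then have "0 \<le> s + \<tau> i" "\<tau> i < \<tau> (Suc i)"
      using nn assms by (auto simp: strict_mono_on_def)
    then show "distr M borel (\<lambda>\<omega>. B (s + \<tau> (Suc i)) \<omega> - B (s + \<tau> i) \<omega>)
      = density lborel (normal_density 0 (sqrt (\<tau> (Suc i) - \<tau> i)))"
      using distr_increment[of "s + \<tau> i" "s + \<tau> (Suc i)"] by simp
  qed simp
  finally show ?thesis .
qed

text \<open>The interval from 0 to \<open>s\<close> is put in front of the shifted grid. All
  increments over the longer grid are independent, hence so are the first one and the block of the
  others.\<close>

lemma prob_indep_increments:
  assumes "0 < s" and \<tau>: "\<tau> 0 = 0" "strict_mono_on {..n} \<tau>"
    and A: "A \<in> sets borel" and S: "S \<in> sets (\<Pi>\<^sub>M i\<in>{..<n}. borel)"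
  defines "X \<equiv> \<lambda>\<omega>. B s \<omega> - B 0 \<omega>"
    and "Y \<equiv> \<lambda>\<omega>. \<lambda>i\<in>{..<n}. B (s + \<tau> (Suc i)) \<omega> - B (s + \<tau> i) \<omega>"
  shows "prob {\<omega> \<in> space M. X \<omega> \<in> A \<and> Y \<omega> \<in> S} =
    prob {\<omega> \<in> space M. X \<omega> \<in> A} * prob {\<omega> \<in> space M. Y \<omega> \<in> S}"
proof -
  \<comment> \<open>The grid 0, \<open>s\<close>, \<open>s + \<tau> 1\<close>, and so on. As
    \<open>\<tau> 0 = 0\<close>, its increment with index 0 is \<open>X\<close>, and the indices 1
    to \<open>n\<close> give the components of \<open>Y\<close> shifted by one.\<close>
  define \<sigma> where "\<sigma> i = (case i of 0 \<Rightarrow> 0 | Suc k \<Rightarrow> s + \<tau> k)" for i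
  have nn: "0 \<le> \<tau> i" if "i \<le> n" for i
    using strict_mono_on_leD[OF \<tau>(2), of 0 i] that \<tau>(1) by auto
  have "strict_mono_on {..Suc n} \<sigma>"
  proof (rule strict_mono_onI)
    fix i j assume "i \<in> {..Suc n}" "j \<in> {..Suc n}" "i < j"
    then show "\<sigma> i < \<sigma> j"
      using nn[of "j - 1"] \<open>0 < s\<close> strict_mono_onD[OF \<tau>(2), of "i - 1" "j - 1"]
      by (auto simp: \<sigma>_def split: nat.split)
  qed
  then have iv: "indep_vars (\<lambda>_. borel) (\<lambda>i \<omega>. B (\<sigma> (Suc i)) \<omega> - B (\<sigma> i) \<omega>) {..<Suc n}"
    by (intro independent_increments) (simp_all add: \<sigma>_def[of 0])
  define X' where "X' \<omega> = (\<lambda>i\<in>{0}. B (\<sigma> (Suc i)) \<omega> - B (\<sigma> i) \<omega>)" for \<omega>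
  define Y' where "Y' \<omega> = (\<lambda>i\<in>{1..<Suc n}. B (\<sigma> (Suc i)) \<omega> - B (\<sigma> i) \<omega>)" for \<omega>
  have ind: "indep_var (\<Pi>\<^sub>M i\<in>{0}. borel) X' (\<Pi>\<^sub>M i\<in>{1..<Suc n}. borel) Y'" (is "indep_var ?N _ ?N' _")
    unfolding X'_def Y'_def by (rule indep_var_restrict[OF iv]) auto
  define A' where "A' = (\<lambda>d. d 0) -` A \<inter> space ?N"
  define S' where "S' = (\<lambda>d. \<lambda>i\<in>{..<n}. d (Suc i)) -` S \<inter> space ?N'"
  have A': "A' \<in> sets ?N"
    unfolding A'_def by (rule measurable_sets[OF _ A]) simp
  have S': "S' \<in> sets ?N'"
    unfolding S'_def by (rule measurable_sets[OF _ S]) (auto intro!: measurable_restrict)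
  have X: "X' \<omega> \<in> A' \<longleftrightarrow> X \<omega> \<in> A" for \<omega>
    by (auto simp: X_def X'_def A'_def \<sigma>_def \<tau> space_PiM)
  have Y: "Y' \<omega> \<in> S' \<longleftrightarrow> Y \<omega> \<in> S" for \<omega>
  proof -
    have "(\<lambda>i\<in>{..<n}. Y' \<omega> (Suc i)) = Y \<omega>"
      by (auto simp: Y_def Y'_def \<sigma>_def fun_eq_iff)
    moreover have "Y' \<omega> \<in> space ?N'"
      by (auto simp: Y'_def space_PiM)
    ultimately show ?thesis by (auto simp: S'_def)
  qed
  show ?thesis
    using indep_varD[OF ind A' S'] by (simp add: vimage_def Int_def X Y conj_commute conj_left_commute)
qed

text \<open>Values of the path at finitely many times are partial sums of consecutive increments
  over the sorted times. The grid and \<open>S\<close> serve every \<open>s\<close> simultaneously,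
  so the cylinder probability at time \<open>s\<close> can be compared with that at time 0.\<close>

lemma increment_path_cylinder:
  assumes J: "finite J" "J \<subseteq> {0..}" and F: "\<And>t. t \<in> J \<Longrightarrow> F t \<in> sets borel"
  obtains n :: nat and \<tau> :: "nat \<Rightarrow> real" and S where
    "0 < n" "\<tau> 0 = 0" "strict_mono_on {..n} \<tau>" "S \<in> sets (\<Pi>\<^sub>M i\<in>{..<n}. borel)"
    "\<And>s \<omega>. increment_path B s \<omega> \<in> prod_emb {0..} (\<lambda>_. borel) J (Pi\<^sub>E J F) \<longleftrightarrow>
       (\<lambda>i\<in>{..<n}. B (s + \<tau> (Suc i)) \<omega> - B (s + \<tau> i) \<omega>) \<in> S"
proof -
  \<comment> \<open>The time 0 makes the sums of increments telescope from the origin. The time 1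
    guarantees a second grid point, hence \<open>0 < n\<close>, even if \<open>J\<close> is empty or
    contains only 0.\<close>
  obtain L where setL: "set L = insert 0 (insert 1 J)" and distL: "distinct L" and sortL: "sorted L"
    using finite_distinct_list[of "insert 0 (insert 1 J)"] J
    by (metis distinct_sort finite_insert set_sort sorted_sort)
  define n where "n = length L - 1"
  have card: "length L = card (insert 0 (insert 1 J))"
    using distinct_card[OF distL] setL by simp
  have "card {0::real, 1} \<le> length L"
    unfolding card using J by (intro card_mono) auto
  then have len: "length L = Suc n" "0 < n" by (auto simp: n_def)
  have mono: "strict_mono_on {..n} ((!) L)"
  proof (rule strict_mono_onI)
    have *: "sorted_wrt (<) L" using distL sortL by (simp add: strict_sorted_iff)
    show "L ! i < L ! j" if "i \<in> {..n}" "j \<in> {..n}" "i < j" for i j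
      using that len sorted_wrt_nth_less[of "(<)" L i j] * by auto
  qed
  have L0: "L ! 0 = 0"
  proof -
    obtain k where k: "k < length L" "L ! k = 0"
      using setL by (metis in_set_conv_nth insertI1)
    have "L ! 0 \<le> L ! k" using sortL k by (intro sorted_nth_mono) auto
    moreover have "L ! 0 \<in> set L" using len by auto
    then have "L ! 0 \<ge> 0" using setL J by auto
    ultimately show ?thesis using k by auto
  qed
  \<comment> \<open>The sum of the first \<open>i\<close> increments recovers the path at time
    \<open>L ! i\<close>; only the grid points that belong to \<open>J\<close> are
    constrained.\<close>
  define S where "S = {d \<in> space (\<Pi>\<^sub>M i\<in>{..<n}. (borel :: real measure)).
    \<forall>i\<in>{i. i \<le> n \<and> L ! i \<in> J}. (\<Sum>j<i. d j) \<in> F (L ! i)}"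
  show ?thesis
  proof (rule that[OF len(2) L0 mono])
    show "S \<in> sets (\<Pi>\<^sub>M i\<in>{..<n}. borel)"
      unfolding S_def
    proof (intro sets.sets_Collect_finite_All)
      fix i assume i: "i \<in> {i. i \<le> n \<and> L ! i \<in> J}"
      have "(\<lambda>d. \<Sum>j<i. d j) \<in> borel_measurable (\<Pi>\<^sub>M i\<in>{..<n}. (borel :: real measure))"
        using i by (intro borel_measurable_sum measurable_component_singleton) auto
      from measurable_sets[OF this F[of "L ! i"]] i
      show "{d \<in> space (\<Pi>\<^sub>M i\<in>{..<n}. borel). (\<Sum>j<i. d j) \<in> F (L ! i)} \<in> sets (\<Pi>\<^sub>M i\<in>{..<n}. borel)"
        by (simp add: vimage_def Int_def conj_commute)
    qed auto
    fix s \<omega>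
    have "increment_path B s \<omega> \<in> prod_emb {0..} (\<lambda>_. borel) J (Pi\<^sub>E J F) \<longleftrightarrow>
        (\<forall>t\<in>J. B (s + t) \<omega> - B s \<omega> \<in> F t)"
      using J by (auto simp: prod_emb_def increment_path_def space_PiM PiE_def Pi_def restrict_def subset_eq extensional_def)
    also have "\<dots> \<longleftrightarrow> (\<forall>i\<in>{i. i \<le> n \<and> L ! i \<in> J}. B (s + L ! i) \<omega> - B s \<omega> \<in> F (L ! i))"
    proof safe
      fix t assume *: "\<forall>i\<in>{i. i \<le> n \<and> L ! i \<in> J}. B (s + L ! i) \<omega> - B s \<omega> \<in> F (L ! i)" "t \<in> J"
      then obtain i where "i < length L" "t = L ! i"
        using setL by (metis in_set_conv_nth insertI2)
      then show "B (s + t) \<omega> - B s \<omega> \<in> F t"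
        using * len by auto
    qed auto
    also have "\<dots> \<longleftrightarrow> (\<lambda>i\<in>{..<n}. B (s + L ! Suc i) \<omega> - B (s + L ! i) \<omega>) \<in> S"
    proof -
      have "(\<Sum>j<i. (\<lambda>i\<in>{..<n}. B (s + L ! Suc i) \<omega> - B (s + L ! i) \<omega>) j) = B (s + L ! i) \<omega> - B s \<omega>"
        if "i \<le> n" for i
      proof -
        have "(\<Sum>j<i. (\<lambda>i\<in>{..<n}. B (s + L ! Suc i) \<omega> - B (s + L ! i) \<omega>) j) =
          (\<Sum>j<i. B (s + L ! Suc j) \<omega> - B (s + L ! j) \<omega>)"
          using that by (intro sum.cong) auto
        then show ?thesis
          using sum_increments[of "\<lambda>j. B (s + L ! j) \<omega>" i] L0 by simp
      qed
      then show ?thesis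
        by (auto simp: S_def space_PiM)
    qed
    finally show "increment_path B s \<omega> \<in> prod_emb {0..} (\<lambda>_. borel) J (Pi\<^sub>E J F) \<longleftrightarrow>
        (\<lambda>i\<in>{..<n}. B (s + L ! Suc i) \<omega> - B (s + L ! i) \<omega>) \<in> S" .
  qed
qed

text \<open>The increments from time 0 are used because \<open>B 0\<close> vanishes only almost
  surely.\<close>

definition wiener :: "(real \<Rightarrow> real) measure" where
  "wiener = distr M path_space (increment_path B 0)"

lemma sets_wiener[simp, measurable_cong]: "sets wiener = sets path_space"
  by (simp add: wiener_def)

lemma prob_space_wiener: "prob_space wiener"
  unfolding wiener_def by (intro prob_space_distr measurable_increment_path) simp

text \<open>For fixed \<open>A\<close> both sides are finite measures in \<open>E\<close>. They
  agree on cylinders, by independence of the increments and stationarity, and cylinders generate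
  \<open>path_space\<close>.\<close>

lemma markov_rectangle:
  assumes "0 < s" "A \<in> sets borel" "E \<in> sets path_space"
  shows "emeasure M {\<omega> \<in> space M. B s \<omega> - B 0 \<omega> \<in> A \<and> increment_path B s \<omega> \<in> E} =
    emeasure M {\<omega> \<in> space M. B s \<omega> - B 0 \<omega> \<in> A} * emeasure wiener E"
proof -
  define H where "H = {\<omega> \<in> space M. B s \<omega> - B 0 \<omega> \<in> A}"
  have H[measurable]: "H \<in> events"
  proof -
    have [measurable]: "random_variable borel (\<lambda>\<omega>. B s \<omega> - B 0 \<omega>)" "A \<in> sets borel"
      using assms by auto
    show ?thesis unfolding H_def by measurable
  qed
  have ps[measurable]: "increment_path B s \<in> M \<rightarrow>\<^sub>M path_space" "increment_path B 0 \<in> M \<rightarrow>\<^sub>M path_space"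
    using assms by (auto intro!: measurable_increment_path)
  \<comment> \<open>The law of the path after \<open>s\<close> on the event \<open>H\<close>, not
    normalised, so that \<open>H\<close> may be a null set.\<close>
  define P where "P = distr (density M (indicator H)) path_space (increment_path B s)"
  define Q where "Q = scale_measure (emeasure M H) wiener"
  have eP: "emeasure P E = emeasure M {\<omega> \<in> space M. B s \<omega> - B 0 \<omega> \<in> A \<and> increment_path B s \<omega> \<in> E}"
    if E: "E \<in> sets path_space" for E
  proof -
    have "emeasure P E = emeasure (density M (indicator H)) (increment_path B s -` E \<inter> space M)"
      unfolding P_def by (subst emeasure_distr) (use E in auto)
    also have "\<dots> = (\<integral>\<^sup>+\<omega>. indicator H \<omega> * indicator (increment_path B s -` E \<inter> space M) \<omega> \<partial>M)"
      using measurable_sets[OF ps(1) E] by (subst emeasure_density) auto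
    also have "\<dots> = (\<integral>\<^sup>+\<omega>. indicator (H \<inter> (increment_path B s -` E \<inter> space M)) \<omega> \<partial>M)"
      by (intro nn_integral_cong) (auto simp: indicator_def)
    also have "\<dots> = emeasure M (H \<inter> (increment_path B s -` E \<inter> space M))"
      using measurable_sets[OF ps(1) E] by simp
    also have "H \<inter> (increment_path B s -` E \<inter> space M) =
        {\<omega> \<in> space M. B s \<omega> - B 0 \<omega> \<in> A \<and> increment_path B s \<omega> \<in> E}"
      by (auto simp: H_def)
    finally show ?thesis .
  qed
  have finP: "finite_measure P"
  proof
    have "emeasure P (space path_space) \<le> 1"
      by (subst eP) (auto intro: emeasure_le_1)
    then show "emeasure P (space P) \<noteq> \<infinity>"
      by (auto simp: P_def top_unique)
  qed
  have eq: "emeasure P (prod_emb {0..} (\<lambda>_. borel) J (Pi\<^sub>E J F)) =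
      emeasure Q (prod_emb {0..} (\<lambda>_. borel) J (Pi\<^sub>E J F))"
    if J: "finite J" "J \<subseteq> {0..}" and F: "\<And>i. i \<in> J \<Longrightarrow> F i \<in> sets borel"
    for F :: "real \<Rightarrow> real set" and J
  proof -
    let ?C = "prod_emb {0..} (\<lambda>_. borel) J (Pi\<^sub>E J F)"
    have C: "?C \<in> sets path_space"
      using J F by (intro sets_PiM_I) auto
    obtain n \<tau> S where S: "0 < n" "\<tau> 0 = 0" "strict_mono_on {..n} \<tau>" "S \<in> sets (\<Pi>\<^sub>M i\<in>{..<n}. borel)"
      and iff: "\<And>s \<omega>. increment_path B s \<omega> \<in> ?C \<longleftrightarrow>
       (\<lambda>i\<in>{..<n}. B (s + \<tau> (Suc i)) \<omega> - B (s + \<tau> i) \<omega>) \<in> S"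
      by (rule increment_path_cylinder[OF J, of F], erule F, rule that; assumption)
    let ?inc = "\<lambda>s \<omega>. \<lambda>i\<in>{..<n}. B (s + \<tau> (Suc i)) \<omega> - B (s + \<tau> i) \<omega>"
    have nn: "0 \<le> \<tau> i" if "i \<le> n" for i
      using strict_mono_on_leD[OF S(3), of 0 i] that S(2) by auto
    have inc: "?inc s \<in> M \<rightarrow>\<^sub>M (\<Pi>\<^sub>M i\<in>{..<n}. borel)" if "0 \<le> s" for s
      using nn that by (intro measurable_restrict borel_measurable_diff measurable_B) auto
    have law: "emeasure M (?inc s -` S \<inter> space M) = emeasure wiener ?C"
    proof -
      have "emeasure M (?inc s -` S \<inter> space M) = emeasure (distr M (\<Pi>\<^sub>M i\<in>{..<n}. borel) (?inc s)) S"
        using S inc assms by (subst emeasure_distr) auto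
      also have "distr M (\<Pi>\<^sub>M i\<in>{..<n}. borel) (?inc s) = distr M (\<Pi>\<^sub>M i\<in>{..<n}. borel) (?inc 0)"
        using assms distr_increments[of s n \<tau>] distr_increments[of 0 n \<tau>] S by simp
      also have "emeasure \<dots> S = emeasure M (?inc 0 -` S \<inter> space M)"
        using S inc[of 0] by (subst emeasure_distr) auto
      also have "?inc 0 -` S \<inter> space M = increment_path B 0 -` ?C \<inter> space M"
        using iff[of 0] by auto
      also have "emeasure M \<dots> = emeasure wiener ?C"
        unfolding wiener_def using C by (subst emeasure_distr) auto
      finally show ?thesis .
    qed
    have "emeasure P ?C = ennreal (prob {\<omega> \<in> space M. B s \<omega> - B 0 \<omega> \<in> A \<and> ?inc s \<omega> \<in> S})"
      unfolding eP[OF C] iff by (simp add: emeasure_eq_measure)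
    also have "\<dots> = emeasure M H * emeasure M {\<omega> \<in> space M. ?inc s \<omega> \<in> S}"
      unfolding prob_indep_increments[OF \<open>0 < s\<close> S(2,3) \<open>A \<in> sets borel\<close> S(4)]
      by (simp add: emeasure_eq_measure ennreal_mult H_def)
    also have "{\<omega> \<in> space M. ?inc s \<omega> \<in> S} = ?inc s -` S \<inter> space M"
      by auto
    also note law
    also have "emeasure M H * emeasure wiener ?C = emeasure Q ?C"
      unfolding Q_def by (rule emeasure_scale_measure[symmetric])
    finally show "emeasure P ?C = emeasure Q ?C" .
  qed
  have sets: "sets P = sets path_space" "sets Q = sets path_space"
    by (auto simp: P_def Q_def)
  have PQ: "P = Q"
    by (rule measure_eqI_PiM_infinite[OF sets eq finP])
  have "emeasure P E = emeasure M H * emeasure wiener E"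
    unfolding PQ Q_def by (rule emeasure_scale_measure)
  then show ?thesis
    unfolding eP[OF assms(3)] H_def .
qed

lemma markov:
  assumes "0 < s"
  shows "distr M (borel \<Otimes>\<^sub>M path_space) (\<lambda>\<omega>. (B s \<omega> - B 0 \<omega>, increment_path B s \<omega>)) =
    density lborel (normal_density 0 (sqrt s)) \<Otimes>\<^sub>M wiener"
proof -
  let ?D = "distr M borel (\<lambda>\<omega>. B s \<omega> - B 0 \<omega>)"
  have [measurable]: "random_variable borel (\<lambda>\<omega>. B s \<omega> - B 0 \<omega>)"
    using assms by auto
  have [measurable]: "increment_path B s \<in> M \<rightarrow>\<^sub>M path_space"
    using assms by (intro measurable_increment_path) auto
  interpret D: prob_space ?D by (rule prob_space_distr) simp
  interpret W: prob_space wiener by (rule prob_space_wiener)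
  have "?D \<Otimes>\<^sub>M wiener = distr M (borel \<Otimes>\<^sub>M path_space) (\<lambda>\<omega>. (B s \<omega> - B 0 \<omega>, increment_path B s \<omega>))"
  proof (rule pair_measure_eqI)
    show "sigma_finite_measure ?D" "sigma_finite_measure wiener" by unfold_locales
    show "sets (?D \<Otimes>\<^sub>M wiener) = sets (distr M (borel \<Otimes>\<^sub>M path_space) (\<lambda>\<omega>. (B s \<omega> - B 0 \<omega>, increment_path B s \<omega>)))"
      by (simp cong: sets_pair_measure_cong)
    fix A E assume "A \<in> sets ?D" "E \<in> sets wiener"
    then have AE[measurable]: "A \<in> sets borel" "E \<in> sets path_space" by auto
    show "emeasure ?D A * emeasure wiener E = emeasure (distr M (borel \<Otimes>\<^sub>M path_space) (\<lambda>\<omega>. (B s \<omega> - B 0 \<omega>, increment_path B s \<omega>))) (A \<times> E)"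
      using markov_rectangle[OF assms AE]
      by (simp add: emeasure_distr vimage_def Int_def conj_commute)
  qed
  then show ?thesis
    using distr_increment[of 0 s] assms by simp
qed

end

section \<open>The integrated chain rule\<close>

text \<open>Dominated convergence with majorant \<open>\<bar>g t\<bar>\<close>: the indicators of
  the half-lines converge at every point except possibly \<open>x\<close>, which is a null
  set.\<close>

lemma continuous_integral_tail:
  fixes g :: "real \<Rightarrow> real"
  assumes "integrable lborel g"
  shows "continuous_on UNIV (\<lambda>x. LINT t:{x..}|lborel. g t)"
  unfolding continuous_on_sequentially
proof (intro ballI allI impI)
  fix x :: real and u assume u: "(\<forall>n. u n \<in> UNIV) \<and> u \<longlonglongrightarrow> x"
  show "((\<lambda>x. LINT t:{x..}|lborel. g t) \<circ> u) \<longlonglongrightarrow> (LINT t:{x..}|lborel. g t)"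
    unfolding comp_def set_lebesgue_integral_def
  proof (rule integral_dominated_convergence[where w="\<lambda>t. \<bar>g t\<bar>"])
    show "AE t in lborel. (\<lambda>n. indicator {u n..} t *\<^sub>R g t) \<longlonglongrightarrow> indicator {x..} t *\<^sub>R g t"
      using AE_lborel_singleton[of x]
    proof eventually_elim
      fix t assume "t \<noteq> x"
      then consider "t < x" | "x < t" by linarith
      then have "eventually (\<lambda>n. indicator {u n..} t = (indicator {x..} t :: real)) sequentially"
      proof cases
        case 1
        then have "eventually (\<lambda>n. t < u n) sequentially" using u order_tendstoD(1) by blast
        then show ?thesis by eventually_elim (use 1 in \<open>auto simp: indicator_def\<close>)
      next
        case 2
        then have "eventually (\<lambda>n. u n < t) sequentially" using u order_tendstoD(2) by blast
        then show ?thesis by eventually_elim (use 2 in \<open>auto simp: indicator_def\<close>)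
      qed
      then show "(\<lambda>n. indicator {u n..} t *\<^sub>R g t) \<longlonglongrightarrow> indicator {x..} t *\<^sub>R g t"
        by (intro tendsto_scaleR tendsto_eventually tendsto_const)
    qed
  qed (use assms in \<open>auto simp: indicator_def\<close>)
qed

lemma tendsto_integral_tail_0:
  fixes g :: "real \<Rightarrow> real"
  assumes "integrable lborel g"
  shows "((\<lambda>x. LINT t:{x..}|lborel. g t) \<longlongrightarrow> 0) at_top"
proof (rule tendsto_at_topI_sequentially)
  fix X :: "nat \<Rightarrow> real" assume X: "filterlim X at_top sequentially"
  have "(\<lambda>n. LINT t:{X n..}|lborel. g t) \<longlonglongrightarrow> (LINT t|(lborel :: real measure). 0)"
    unfolding set_lebesgue_integral_def
  proof (rule integral_dominated_convergence[where w="\<lambda>t. \<bar>g t\<bar>"])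
    show "AE t in lborel. (\<lambda>n. indicator {X n..} t *\<^sub>R g t) \<longlonglongrightarrow> 0"
    proof (rule AE_I2)
      fix t
      have "eventually (\<lambda>n. t < X n) sequentially"
        using X filterlim_at_top_dense by blast
      then have "eventually (\<lambda>n. indicator {X n..} t *\<^sub>R g t = 0) sequentially"
        by eventually_elim (auto simp: indicator_def)
      then show "(\<lambda>n. indicator {X n..} t *\<^sub>R g t) \<longlonglongrightarrow> 0"
        by (rule tendsto_eventually)
    qed
  qed (use assms in \<open>auto simp: indicator_def\<close>)
  then show "(\<lambda>n. LINT t:{X n..}|lborel. g t) \<longlonglongrightarrow> 0" by simp
qed

text \<open>Under the measure with density \<open>g\<close> the tail integral \<open>a\<close> is uniformly distributed on
  \<open>[0, a 0]\<close>: this replaces the chain rule for \<open>exp (- \<gamma> a s)\<close>, as \<open>g\<close> need not be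
  continuous.\<close>

lemma distr_tail_integral:
  fixes g :: "real \<Rightarrow> real"
  assumes int: "integrable lborel g" and nonneg: "\<And>t. 0 \<le> g t" and zero: "\<And>t. t < 0 \<Longrightarrow> g t = 0"
  defines "a \<equiv> \<lambda>x. LINT t:{x..}|lborel. g t"
  shows "distr (density lborel g) borel a = density lborel (indicator {0..a 0})"
proof (rule cdf_unique')
  have [measurable]: "g \<in> borel_measurable borel" using int by simp
  have a_cont: "continuous_on A a" for A
    unfolding a_def using continuous_integral_tail[OF int] continuous_on_subset by blast
  then have [measurable]: "a \<in> borel_measurable borel"
    by (intro borel_measurable_continuous_onI)
  have si: "set_integrable lborel A g" if "A \<in> sets borel" for A
    using int that unfolding set_integrable_def by (intro integrable_mult_indicator) auto
  have a_nonneg: "0 \<le> a x" for x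
    unfolding a_def set_lebesgue_integral_def using nonneg by (intro integral_nonneg_AE) auto
  have a_anti: "a y \<le> a x" if "x \<le> y" for x y
    unfolding a_def set_lebesgue_integral_def
    using si[of "{x..}"] si[of "{y..}"] nonneg that
    by (intro integral_mono) (auto simp: set_integrable_def indicator_def)
  have nu: "emeasure (density lborel g) {x..} = ennreal (a x)" for x
  proof -
    have "emeasure (density lborel g) {x..} = (\<integral>\<^sup>+t. ennreal (indicator {x..} t *\<^sub>R g t) \<partial>lborel)"
      by (subst emeasure_density) (auto intro!: nn_integral_cong simp: indicator_def)
    also have "\<dots> = ennreal (a x)"
      unfolding a_def set_lebesgue_integral_def using si[of "{x..}"] nonneg
      by (intro nn_integral_eq_integral) (auto simp: set_integrable_def)
    finally show ?thesis .
  qed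
  have nu_UNIV: "emeasure (density lborel g) UNIV = ennreal (a 0)"
  proof -
    have "emeasure (density lborel g) UNIV = emeasure (density lborel g) {0..}"
      using zero by (simp add: emeasure_density, intro nn_integral_cong) (auto simp: indicator_def not_le)
    then show ?thesis by (simp add: nu)
  qed
  interpret N: finite_measure "density lborel g"
    by standard (use nu_UNIV in auto)
  have fin: "emeasure (density lborel g) A \<le> ennreal (a 0)" for A
    using emeasure_space[of "density lborel g" A] nu_UNIV by simp
  show fbm1: "finite_borel_measure (distr (density lborel g) borel a)"
    by (intro finite_borel_measure.intro finite_borel_measure_axioms.intro N.finite_measure_distr) auto
  show fbm2: "finite_borel_measure (density lborel (indicator {0..a 0}))"
    by (intro finite_borel_measure.intro finite_borel_measure_axioms.intro finite_measureI)
       (use a_nonneg[of 0] in \<open>auto simp: emeasure_density\<close>)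
  have level: "\<exists>\<sigma>\<ge>0. a \<sigma> = u" if "0 < u" "u \<le> a 0" for u
  proof -
    have "eventually (\<lambda>x. a x < u) at_top"
      using order_tendstoD(2)[OF tendsto_integral_tail_0[OF int]] that unfolding a_def by blast
    then obtain b where "0 \<le> b" "a b < u"
      using eventually_conj[OF eventually_ge_at_top[of 0]] eventually_happens'[of at_top]
      by (metis (mono_tags, lifting) trivial_limit_at_top_linorder)
    then show ?thesis
      using IVT2'[of a b u 0] a_cont that by auto
  qed
  have emb: "emeasure (distr (density lborel g) borel a) {..u} = ennreal (max 0 (min u (a 0)))" for u
  proof -
    have "emeasure (distr (density lborel g) borel a) {..u} = emeasure (density lborel g) {x. a x \<le> u}"
      by (subst emeasure_distr) (auto simp: vimage_def)
    also have "\<dots> = ennreal (max 0 (min u (a 0)))"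
    proof -
      consider "u < 0" | "a 0 \<le> u" "0 \<le> u" | "0 \<le> u" "u < a 0" by linarith
      then show ?thesis
      proof cases
        case 1
        then have "{x. a x \<le> u} = {}" using a_nonneg by (auto simp: not_le intro: less_le_trans)
        then show ?thesis using 1 by simp
      next
        case 2
        have "emeasure (density lborel g) {0..} \<le> emeasure (density lborel g) {x. a x \<le> u}"
          using 2 a_anti by (intro emeasure_mono) (auto intro: order_trans)
        then show ?thesis
          using fin[of "{x. a x \<le> u}"] 2 a_nonneg[of 0] by (simp add: nu min_def)
      next
        case 3
        \<comment> \<open>\<open>a\<close> may be constant at level \<open>u\<close>, so a point
          where \<open>u\<close> is attained need not be the left end of the sublevel set. A point
          at the slightly higher level \<open>u'\<close> lies to the left of the whole set.\<close>
        have "emeasure (density lborel g) {x. a x \<le> u} \<le> ennreal u"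
        proof (rule ennreal_le_epsilon)
          fix e :: real assume "0 < e"
          define u' where "u' = min (u + e) (a 0)"
          have u': "u < u'" "u' \<le> a 0" "u' \<le> u + e" using \<open>0 < e\<close> 3 by (auto simp: u'_def)
          with level[of u'] 3 obtain \<sigma> where \<sigma>: "a \<sigma> = u'" by auto
          have "{x. a x \<le> u} \<subseteq> {\<sigma>..}"
          proof safe
            fix s assume "a s \<le> u" then show "\<sigma> \<le> s"
              using a_anti[of s \<sigma>] \<sigma> u' by linarith
          qed
          then have "emeasure (density lborel g) {x. a x \<le> u} \<le> emeasure (density lborel g) {\<sigma>..}"
            by (intro emeasure_mono) auto
          also have "\<dots> \<le> ennreal (u + e)" using u' by (simp add: nu \<sigma> ennreal_leI)
          finally show "emeasure (density lborel g) {x. a x \<le> u} \<le> ennreal u + ennreal e"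
            using 3 \<open>0 < e\<close> by (simp add: ennreal_plus)
        qed
        moreover have "ennreal u \<le> emeasure (density lborel g) {x. a x \<le> u}"
        \<comment> \<open>The level 0 need not be attained by \<open>a\<close>, but there the bound
          is trivial.\<close>
        proof (cases "u = 0")
          case False
          with level[of u] 3 obtain \<sigma> where \<sigma>: "a \<sigma> = u" by auto
          then have "emeasure (density lborel g) {\<sigma>..} \<le> emeasure (density lborel g) {x. a x \<le> u}"
            using a_anti by (intro emeasure_mono) auto
          then show ?thesis by (simp add: nu \<sigma>)
        qed auto
        ultimately show ?thesis using 3 by (simp add: min_def)
      qed
    qed
    finally show ?thesis .
  qed
  have em2: "emeasure (density lborel (indicator {0..a 0})) {..u} = ennreal (max 0 (min u (a 0)))" for u
  proof -
    have "emeasure (density lborel (indicator {0..a 0})) {..u} = (\<integral>\<^sup>+t. indicator {0..min u (a 0)} t \<partial>lborel)"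
      by (subst emeasure_density, simp, simp, intro nn_integral_cong) (auto simp: indicator_def)
    then show ?thesis by (auto simp: max_def min_def)
  qed
  show "cdf (distr (density lborel g) borel a) = cdf (density lborel (indicator {0..a 0}))"
    by (simp add: fun_eq_iff cdf_def2 measure_def emb em2)
qed

text \<open>The substitution \<open>u = a s\<close> turns the left side into the integral of
  \<open>\<gamma> * exp (- \<gamma> * u)\<close> over \<open>{0..a 0}\<close>. It is justified by
  the uniform law of the tail integral.\<close>

lemma nn_integral_exp_tail:
  fixes g :: "real \<Rightarrow> real"
  assumes [measurable]: "g \<in> borel_measurable borel" and nonneg: "\<And>t. 0 \<le> g t" and "0 < \<gamma>"
    and fin: "(\<integral>\<^sup>+t\<in>{0..}. g t \<partial>lborel) < \<infinity>"
  shows "(\<integral>\<^sup>+s\<in>{0..}. ennreal (\<gamma> * g s) * ennreal (exp_neg (\<gamma> * (\<integral>\<^sup>+t\<in>{s..}. g t \<partial>lborel))) \<partial>lborel) =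
    ennreal (1 - exp_neg (\<gamma> * (\<integral>\<^sup>+t\<in>{0..}. g t \<partial>lborel)))"
proof -
  \<comment> \<open>The cut-off places all mass on nonnegative times, as the uniform law requires,
    and leaves the tails from \<open>s \<ge> 0\<close> unchanged.\<close>
  define h where "h t = indicator {0..} t * g t" for t
  have [measurable]: "h \<in> borel_measurable borel" unfolding h_def by measurable
  have h_nonneg: "0 \<le> h t" for t using nonneg by (simp add: h_def)
  have int: "integrable lborel h"
  proof (rule integrableI_nonneg)
    have "(\<integral>\<^sup>+t. h t \<partial>lborel) = (\<integral>\<^sup>+t\<in>{0..}. g t \<partial>lborel)"
      by (intro nn_integral_cong) (auto simp: h_def indicator_def)
    then show "(\<integral>\<^sup>+t. h t \<partial>lborel) < \<infinity>" using fin by simp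
  qed (auto simp: h_nonneg)
  define a where "a x = (LINT t:{x..}|lborel. h t)" for x
  have a_cont: "continuous_on UNIV a"
    unfolding a_def by (rule continuous_integral_tail[OF int])
  then have [measurable]: "a \<in> borel_measurable borel"
    by (intro borel_measurable_continuous_onI)
  have a_nonneg: "0 \<le> a x" for x
    unfolding a_def set_lebesgue_integral_def using h_nonneg by (intro integral_nonneg_AE) auto
  have tail: "(\<integral>\<^sup>+t\<in>{s..}. g t \<partial>lborel) = ennreal (a s)" if "0 \<le> s" for s
  proof -
    have "(\<integral>\<^sup>+t\<in>{s..}. g t \<partial>lborel) = (\<integral>\<^sup>+t. ennreal (indicator {s..} t *\<^sub>R h t) \<partial>lborel)"
      using that by (intro nn_integral_cong) (auto simp: h_def indicator_def)
    also have "\<dots> = ennreal (a s)"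
      unfolding a_def set_lebesgue_integral_def using int h_nonneg
      by (intro nn_integral_eq_integral integrable_mult_indicator) auto
    finally show ?thesis .
  qed
  have en: "exp_neg (\<gamma> * (\<integral>\<^sup>+t\<in>{s..}. g t \<partial>lborel)) = exp (- \<gamma> * a s)" if "0 \<le> s" for s
    using that a_nonneg[of s] \<open>0 < \<gamma>\<close> by (simp add: tail exp_neg_def flip: ennreal_mult)
  have "(\<integral>\<^sup>+s\<in>{0..}. ennreal (\<gamma> * g s) * ennreal (exp_neg (\<gamma> * (\<integral>\<^sup>+t\<in>{s..}. g t \<partial>lborel))) \<partial>lborel) =
      (\<integral>\<^sup>+s. ennreal (h s) * ennreal (\<gamma> * exp (- \<gamma> * a s)) \<partial>lborel)"
  proof (rule nn_integral_cong)
    fix s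
    show "ennreal (\<gamma> * g s) * ennreal (exp_neg (\<gamma> * (\<integral>\<^sup>+t\<in>{s..}. g t \<partial>lborel))) * indicator {0..} s =
      ennreal (h s) * ennreal (\<gamma> * exp (- \<gamma> * a s))"
    proof (cases "0 \<le> s")
      case True
      then show ?thesis
        unfolding en[OF True] h_def using \<open>0 < \<gamma>\<close> nonneg[of s] by (simp add: mult_ac flip: ennreal_mult)
    qed (simp add: h_def)
  qed
  also have "\<dots> = (\<integral>\<^sup>+s. ennreal (\<gamma> * exp (- \<gamma> * a s)) \<partial>density lborel h)"
    by (subst nn_integral_density) auto
  also have "\<dots> = (\<integral>\<^sup>+u. ennreal (\<gamma> * exp (- \<gamma> * u)) \<partial>distr (density lborel h) borel a)"
    by (subst nn_integral_distr) auto
  also have "distr (density lborel h) borel a = density lborel (indicator {0..a 0})"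
    unfolding a_def by (rule distr_tail_integral[OF int h_nonneg]) (auto simp: h_def)
  also have "(\<integral>\<^sup>+u. ennreal (\<gamma> * exp (- \<gamma> * u)) \<partial>density lborel (indicator {0..a 0})) =
      (\<integral>\<^sup>+u. ennreal (\<gamma> * exp (- \<gamma> * u)) * indicator {0..a 0} u \<partial>lborel)"
    by (subst nn_integral_density) (auto simp: mult.commute)
  also have "\<dots> = ennreal (- exp (- \<gamma> * a 0) - (- exp (- \<gamma> * 0)))"
    using \<open>0 < \<gamma>\<close> a_nonneg
    by (intro nn_integral_FTC_Icc) (auto intro!: derivative_eq_intros)
  finally show ?thesis by (simp add: en)
qed

section \<open>The resolvent identity\<close>

text \<open>Values of a continuous path at rational times determine it: this makes path functionals
  measurable for the product \<open>\<sigma>\<close>-algebra, which only sees countably many coordinates.\<close>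

definition eval_path :: "(real \<Rightarrow> real) \<Rightarrow> real \<Rightarrow> real" where
  "eval_path p t = lim (\<lambda>n. p (real (nat \<lceil>t * real (Suc n)\<rceil>) / real (Suc n)))"

lemma measurable_eval_path[measurable]:
  "(\<lambda>x. eval_path (fst x) (snd x)) \<in> borel_measurable (path_space \<Otimes>\<^sub>M borel)"
proof -
  have "(\<lambda>x. fst x (real (nat \<lceil>snd x * real (Suc n)\<rceil>) / real (Suc n)))
      \<in> borel_measurable (path_space \<Otimes>\<^sub>M (borel :: real measure))" for n
  \<comment> \<open>The sampling time takes countably many values, and for each of them the map is a
    single coordinate of the path.\<close>
  proof (rule measurable_compose_countable[where f="\<lambda>k x. fst x (real k / real (Suc n))"
        and g="\<lambda>x. nat \<lceil>snd x * real (Suc n)\<rceil>"])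
    fix k :: nat
    have "real k / real (Suc n) \<in> {0..}" by simp
    then show "(\<lambda>x. fst x (real k / real (Suc n))) \<in> borel_measurable (path_space \<Otimes>\<^sub>M (borel :: real measure))"
      by (intro measurable_compose[OF measurable_fst measurable_component_singleton])
  qed measurable
  then show ?thesis
    unfolding eval_path_def by (rule borel_measurable_lim_metric)
qed

lemma eval_path_restrict:
  assumes "continuous_on {0..} g" "0 \<le> t"
  shows "eval_path (restrict g {0..}) t = g t"
proof -
  define u where "u n = real (nat \<lceil>t * real (Suc n)\<rceil>) / real (Suc n)" for n
  have u: "t \<le> u n" "u n \<le> t + inverse (real (Suc n))" for n
  proof -
    have *: "real (nat \<lceil>t * real (Suc n)\<rceil>) = of_int \<lceil>t * real (Suc n)\<rceil>"
    proof (rule of_nat_nat)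
      have "0 \<le> t * real (Suc n)" using \<open>0 \<le> t\<close> by simp
      then show "0 \<le> \<lceil>t * real (Suc n)\<rceil>" by linarith
    qed
    have "t * real (Suc n) \<le> of_int \<lceil>t * real (Suc n)\<rceil>" by (rule le_of_int_ceiling)
    then show "t \<le> u n"
      unfolding u_def * by (subst pos_le_divide_eq) auto
    have "of_int \<lceil>t * real (Suc n)\<rceil> \<le> t * real (Suc n) + 1" by (rule of_int_ceiling_le_add_one)
    then show "u n \<le> t + inverse (real (Suc n))"
      unfolding u_def * by (subst pos_divide_le_eq) (simp_all add: distrib_right del: of_nat_Suc)
  qed
  have "u \<longlonglongrightarrow> t"
  proof (rule tendsto_sandwich[where f="\<lambda>_. t"])
    show "(\<lambda>n. t + inverse (real (Suc n))) \<longlonglongrightarrow> t"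
      using tendsto_add[OF tendsto_const LIMSEQ_inverse_real_of_nat, of t] by simp
  qed (use u in auto)
  moreover have "u n \<in> {0..}" for n using u(1)[of n] \<open>0 \<le> t\<close> by simp
  ultimately have "(\<lambda>n. g (u n)) \<longlonglongrightarrow> g t"
    using assms unfolding continuous_on_sequentially comp_def by auto
  moreover have "restrict g {0..} (u n) = g (u n)" for n
    using \<open>u n \<in> {0..}\<close> by simp
  ultimately show ?thesis
    unfolding eval_path_def u_def[symmetric] by (simp add: limI)
qed

text \<open>The density, at displacement \<open>z\<close> from the starting point, of the expected
  time spent by Brownian motion with drift \<open>\<mu>\<close>. The exponential factor is the
  probability of ever reaching a point at distance \<open>- z\<close> below the start.\<close>

definition green :: "real \<Rightarrow> real \<Rightarrow> real" where
  "green \<mu> z = (if z < 0 then exp (2 * \<mu> * z) else 1) / \<mu>"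

text \<open>The perpetual integral as a function of a starting point and a path. Evaluation
  \<open>p t\<close> is not jointly measurable in \<open>p\<close> and \<open>t\<close> for the
  product structure; \<open>eval_path\<close> is, and agrees with it on continuous paths.\<close>

definition occupation :: "real \<Rightarrow> (real \<Rightarrow> real) \<Rightarrow> real \<Rightarrow> (real \<Rightarrow> real) \<Rightarrow> ennreal" where
  "occupation \<mu> f y p = (\<integral>\<^sup>+t\<in>{0..}. ennreal (f (y + eval_path p t + \<mu> * t)) \<partial>lborel)"

lemma measurable_green[measurable]: "green \<mu> \<in> borel_measurable borel"
  unfolding green_def by measurable

lemma nn_integral_green:
  fixes k :: "real \<Rightarrow> ennreal"
  assumes "0 < \<mu>" and [measurable]: "k \<in> borel_measurable borel"
  shows "(\<integral>\<^sup>+s\<in>{0<..}. (\<integral>\<^sup>+y. ennreal (normal_density (\<mu> * s) (sqrt s) (y - x)) * k y \<partial>lborel) \<partial>lborel) =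
    (\<integral>\<^sup>+y. ennreal (green \<mu> (y - x)) * k y \<partial>lborel)"
proof -
  have [measurable]: "(\<lambda>(s, y). normal_density (\<mu> * s) (sqrt s) (y - x)) \<in> borel_measurable (lborel \<Otimes>\<^sub>M lborel)"
    unfolding normal_density_def by measurable
  have "(\<integral>\<^sup>+s\<in>{0<..}. (\<integral>\<^sup>+y. ennreal (normal_density (\<mu> * s) (sqrt s) (y - x)) * k y \<partial>lborel) \<partial>lborel) =
    (\<integral>\<^sup>+s. (\<integral>\<^sup>+y. ennreal (normal_density (\<mu> * s) (sqrt s) (y - x)) * k y * indicator {0<..} s \<partial>lborel) \<partial>lborel)"
    by (intro nn_integral_cong nn_integral_multc[symmetric]) measurable
  also have "\<dots> = (\<integral>\<^sup>+y. (\<integral>\<^sup>+s. ennreal (normal_density (\<mu> * s) (sqrt s) (y - x)) * k y * indicator {0<..} s \<partial>lborel) \<partial>lborel)"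
    by (rule lborel_pair.Fubini'[symmetric]) measurable
  also have "\<dots> = (\<integral>\<^sup>+y. (\<integral>\<^sup>+s\<in>{0<..}. normal_density (\<mu> * s) (sqrt s) (y - x) \<partial>lborel) * k y \<partial>lborel)"
    by (intro nn_integral_cong) (subst nn_integral_multc[symmetric], measurable, intro nn_integral_cong, simp add: mult_ac)
  also have "\<dots> = (\<integral>\<^sup>+y. ennreal (green \<mu> (y - x)) * k y \<partial>lborel)"
    \<comment> \<open>The time integral is known for nonzero displacement, that is, for all
      \<open>y\<close> outside the null set containing only \<open>x\<close>.\<close>
    using AE_lborel_singleton[of x]
    by (intro nn_integral_cong_AE)
       (auto simp: green_def nn_integral_normal_density_time[OF \<open>0 < \<mu>\<close>] elim!: eventually_mono)
  finally show ?thesis .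
qed

lemma measurable_exp_neg[measurable]: "exp_neg \<in> borel_measurable borel"
  unfolding exp_neg_def by measurable

lemma exp_neg_nonneg: "0 \<le> exp_neg a" and exp_neg_le_1: "exp_neg a \<le> 1"
  by (auto simp: exp_neg_def)

text \<open>Asking only measurability of \<open>f\<close> lets these results be instantiated at
  truncations of \<open>f\<close> without examining their continuity.\<close>

locale perpetual = standard_brownian_motion M B
  for M :: "'a measure" and B :: "real \<Rightarrow> 'a \<Rightarrow> real" +
  fixes \<mu> \<gamma> :: real and f :: "real \<Rightarrow> real"
  assumes \<mu>: "0 < \<mu>" and \<gamma>: "0 < \<gamma>" and f_nonneg: "\<And>x. 0 \<le> f x"
    and f_measurable[measurable]: "f \<in> borel_measurable borel"
begin

abbreviation X :: "real \<Rightarrow> real \<Rightarrow> 'a \<Rightarrow> real" where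
  "X \<equiv> brownian_with_drift B \<mu>"

abbreviation A :: "real \<Rightarrow> 'a \<Rightarrow> ennreal" where
  "A \<equiv> perpetual_integral B \<mu> f"

abbreviation psi :: "real \<Rightarrow> real" where
  "psi \<equiv> Psi M B \<mu> \<gamma> f"

section \<open>Measurability of the path functionals\<close>

lemma measurable_occupation[measurable]:
  "(\<lambda>x. occupation \<mu> f (fst x) (snd x)) \<in> borel_measurable (borel \<Otimes>\<^sub>M path_space)"
proof -
  have 1: "(\<lambda>z. (snd (fst z), snd z)) \<in> ((borel :: real measure) \<Otimes>\<^sub>M path_space) \<Otimes>\<^sub>M lborel \<rightarrow>\<^sub>M path_space \<Otimes>\<^sub>M borel"
    by measurable
  have [measurable]: "(\<lambda>z. eval_path (snd (fst z)) (snd z)) \<in>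
      borel_measurable (((borel :: real measure) \<Otimes>\<^sub>M path_space) \<Otimes>\<^sub>M lborel)"
    using measurable_compose[OF 1 measurable_eval_path] by simp
  have "(\<lambda>x. \<integral>\<^sup>+t. ennreal (f (fst x + eval_path (snd x) t + \<mu> * t)) * indicator {0..} t \<partial>lborel)
      \<in> borel_measurable ((borel :: real measure) \<Otimes>\<^sub>M path_space)"
    by (rule lborel.borel_measurable_nn_integral) (simp add: case_prod_beta)
  then show ?thesis unfolding occupation_def .
qed

lemma measurable_occupation_path: "occupation \<mu> f x \<in> borel_measurable path_space"
proof -
  have "(\<lambda>p. (x, p)) \<in> path_space \<rightarrow>\<^sub>M borel \<Otimes>\<^sub>M path_space" by simp
  from measurable_compose[OF this measurable_occupation] show ?thesis by simp
qed

text \<open>Since all paths are continuous, \<open>B\<close> is recovered jointly in time and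
  \<open>\<omega>\<close> through \<open>eval_path\<close>. The indicator is there because
  \<open>B\<close> is unconstrained at negative times.\<close>

lemma measurable_X_joint[measurable]:
  "(\<lambda>z. indicator {0..} (fst z) * X x (fst z) (snd z)) \<in> borel_measurable (lborel \<Otimes>\<^sub>M M)"
proof -
  have [measurable]: "random_variable borel (B 0)" "random_variable path_space (increment_path B 0)"
    by (auto intro: measurable_B measurable_increment_path)
  have 1: "(\<lambda>z. (increment_path B 0 (snd z), fst z)) \<in> lborel \<Otimes>\<^sub>M M \<rightarrow>\<^sub>M path_space \<Otimes>\<^sub>M borel"
    by measurable
  have [measurable]: "(\<lambda>z. eval_path (increment_path B 0 (snd z)) (fst z)) \<in> borel_measurable (lborel \<Otimes>\<^sub>M M)"
    using measurable_compose[OF 1 measurable_eval_path] by simp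
  have main: "(\<lambda>z. indicator {0..} (fst z) * (x + B 0 (snd z) + eval_path (increment_path B 0 (snd z)) (fst z) + \<mu> * fst z))
      \<in> borel_measurable (lborel \<Otimes>\<^sub>M M)" by measurable
  have ev: "eval_path (increment_path B 0 \<omega>) s = B s \<omega> - B 0 \<omega>" if "0 \<le> s" "\<omega> \<in> space M" for s \<omega>
    unfolding increment_path_def using that
    by (subst eval_path_restrict) (auto intro!: continuous_intros continuous_paths)
  show ?thesis
  proof (rule measurable_cong[THEN iffD1, OF _ main])
    fix z :: "real \<times> 'a" assume "z \<in> space (lborel \<Otimes>\<^sub>M M)"
    then have "snd z \<in> space M" by (auto simp: space_pair_measure)
    then show "indicator {0..} (fst z) * (x + B 0 (snd z) + eval_path (increment_path B 0 (snd z)) (fst z) + \<mu> * fst z)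
        = indicator {0..} (fst z) * X x (fst z) (snd z)"
      using ev[of "fst z" "snd z"] by (cases "0 \<le> fst z") (simp_all add: brownian_with_drift_def)
  qed
qed

lemma measurable_fX_joint[measurable]:
  "(\<lambda>z. ennreal (f (X x (fst z) (snd z))) * indicator {0..} (fst z)) \<in> borel_measurable (lborel \<Otimes>\<^sub>M M)"
proof -
  have "(\<lambda>z. ennreal (f (indicator {0..} (fst z) * X x (fst z) (snd z))) * indicator {0..} (fst z))
      \<in> borel_measurable (lborel \<Otimes>\<^sub>M M)" by measurable
  then show ?thesis
    by (rule measurable_cong[THEN iffD1, rotated]) (auto simp: indicator_def)
qed

lemma measurable_fX[measurable]:
  assumes "\<omega> \<in> space M"
  shows "(\<lambda>s. f (X x s \<omega>) * indicator {0..} s) \<in> borel_measurable borel"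
proof -
  have "(\<lambda>s. (s, \<omega>)) \<in> borel \<rightarrow>\<^sub>M lborel \<Otimes>\<^sub>M M" using assms by measurable
  from measurable_compose[OF this measurable_X_joint[of x]]
  have [measurable]: "(\<lambda>s. indicator {0..} s * X x s \<omega>) \<in> borel_measurable borel" by simp
  have "(\<lambda>s. f (indicator {0..} s * X x s \<omega>) * indicator {0..} s) \<in> borel_measurable borel" by measurable
  then show ?thesis
    by (rule measurable_cong[THEN iffD1, rotated]) (auto simp: indicator_def)
qed

text \<open>A shift of time by \<open>s\<close>. The tail becomes a function of the pair (position
  at \<open>s\<close>, increments after \<open>s\<close>), which is the form to which the Markov
  property applies.\<close>

lemma tail_eq_occupation:
  assumes "\<omega> \<in> space M" "0 \<le> s"
  shows "(\<integral>\<^sup>+t\<in>{s..}. f (X x t \<omega>) \<partial>lborel) = occupation \<mu> f (X x s \<omega>) (increment_path B s \<omega>)"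
proof -
  have [measurable]: "(\<lambda>t. f (X x t \<omega>) * indicator {0..} t) \<in> borel_measurable borel"
    by (rule measurable_fX) fact
  have "(\<integral>\<^sup>+t\<in>{s..}. f (X x t \<omega>) \<partial>lborel) =
      (\<integral>\<^sup>+t. ennreal (f (X x t \<omega>) * indicator {0..} t) * indicator {s..} t \<partial>lborel)"
    using assms by (intro nn_integral_cong) (auto simp: indicator_def)
  also have "\<dots> = (\<integral>\<^sup>+u. ennreal (f (X x (s + u) \<omega>) * indicator {0..} (s + u)) * indicator {s..} (s + u) \<partial>lborel)"
    by (subst nn_integral_real_affine[where c=1 and t=s]) auto
  also have "\<dots> = (\<integral>\<^sup>+u\<in>{0..}. ennreal (f (X x s \<omega> + eval_path (increment_path B s \<omega>) u + \<mu> * u)) \<partial>lborel)"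
  proof (rule nn_integral_cong)
    fix u :: real
    have ev: "eval_path (increment_path B s \<omega>) u = B (s + u) \<omega> - B s \<omega>" if "0 \<le> u"
      unfolding increment_path_def using that assms
      by (subst eval_path_restrict)
        (auto intro!: continuous_intros continuous_on_compose2[OF continuous_paths])
    show "ennreal (f (X x (s + u) \<omega>) * indicator {0..} (s + u)) * indicator {s..} (s + u) =
       ennreal (f (X x s \<omega> + eval_path (increment_path B s \<omega>) u + \<mu> * u)) * indicator {0..} u"
    proof (cases "0 \<le> u")
      case True
      have "X x (s + u) \<omega> = X x s \<omega> + eval_path (increment_path B s \<omega>) u + \<mu> * u"
        unfolding ev[OF True] brownian_with_drift_def by (simp add: algebra_simps)
      then show ?thesis using True assms by simp
    qed simp
  qed
  finally show ?thesis unfolding occupation_def .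
qed

lemma A_eq_occupation:
  assumes "\<omega> \<in> space M"
  shows "A x \<omega> = occupation \<mu> f (X x 0 \<omega>) (increment_path B 0 \<omega>)"
  using tail_eq_occupation[OF assms, of 0 x] by (simp add: perpetual_integral_def)

lemma measurable_A[measurable]: "A x \<in> borel_measurable M"
proof -
  have "(\<lambda>\<omega>. \<integral>\<^sup>+s. ennreal (f (X x s \<omega>)) * indicator {0..} s \<partial>lborel) \<in> borel_measurable M"
  proof (rule lborel.borel_measurable_nn_integral)
    have "(\<lambda>(\<omega>, s). (s, \<omega>)) \<in> M \<Otimes>\<^sub>M lborel \<rightarrow>\<^sub>M lborel \<Otimes>\<^sub>M M" by measurable
    from measurable_compose[OF this measurable_fX_joint[of x]]
    show "(\<lambda>(\<omega>, s). ennreal (f (X x s \<omega>)) * indicator {0..} s) \<in> borel_measurable (M \<Otimes>\<^sub>M lborel)"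
      by (simp add: case_prod_beta)
  qed
  then show ?thesis by (simp add: perpetual_integral_def[abs_def])
qed

lemma psi_bounds: "0 \<le> psi x" "psi x \<le> 1"
proof -
  show "0 \<le> psi x" unfolding Psi_def by (intro integral_nonneg_AE) (simp add: exp_neg_nonneg)
  have "psi x \<le> (LINT \<omega>|M. 1)"
    unfolding Psi_def
    by (intro integral_mono integrable_const_bound[where B=1]) (auto simp: exp_neg_nonneg exp_neg_le_1)
  then show "psi x \<le> 1" by (simp add: prob_space)
qed

lemma nn_integral_exp_neg_A: "(\<integral>\<^sup>+\<omega>. exp_neg (\<gamma> * A x \<omega>) \<partial>M) = ennreal (psi x)"
  unfolding Psi_def
  by (intro nn_integral_eq_integral integrable_const_bound[where B=1]) (auto simp: exp_neg_nonneg exp_neg_le_1)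

text \<open>Here the starting point enters as a parameter under a fixed measure. This yields
  measurability of \<open>psi\<close> and identifies \<open>psi\<close> at \<open>X x s\<close> as
  the conditional expectation of the tail functional.\<close>

lemma psi_eq_wiener: "ennreal (psi x) = (\<integral>\<^sup>+p. exp_neg (\<gamma> * occupation \<mu> f x p) \<partial>wiener)"
proof -
  have [measurable]: "random_variable path_space (increment_path B 0)"
    by (intro measurable_increment_path) simp
  note [measurable] = measurable_occupation_path
  have "ennreal (psi x) = (\<integral>\<^sup>+\<omega>. exp_neg (\<gamma> * A x \<omega>) \<partial>M)"
    by (rule nn_integral_exp_neg_A[symmetric])
  also have "\<dots> = (\<integral>\<^sup>+\<omega>. exp_neg (\<gamma> * occupation \<mu> f x (increment_path B 0 \<omega>)) \<partial>M)"
  proof (rule nn_integral_cong_AE)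
    show "AE \<omega> in M. ennreal (exp_neg (\<gamma> * A x \<omega>)) = exp_neg (\<gamma> * occupation \<mu> f x (increment_path B 0 \<omega>))"
      using start AE_space by eventually_elim (simp add: A_eq_occupation brownian_with_drift_def)
  qed
  also have "\<dots> = (\<integral>\<^sup>+p. exp_neg (\<gamma> * occupation \<mu> f x p) \<partial>wiener)"
    unfolding wiener_def by (subst nn_integral_distr) auto
  finally show ?thesis .
qed

lemma measurable_psi[measurable]: "psi \<in> borel_measurable borel"
proof -
  interpret W: prob_space wiener by (rule prob_space_wiener)
  have "(\<lambda>x. \<integral>\<^sup>+p. exp_neg (\<gamma> * occupation \<mu> f x p) \<partial>wiener) \<in> borel_measurable borel"
    by (rule W.borel_measurable_nn_integral) (simp add: case_prod_beta cong: measurable_cong_sets)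
  then have "(\<lambda>x. ennreal (psi x)) \<in> borel_measurable borel"
    by (simp add: psi_eq_wiener)
  then have "(\<lambda>x. enn2real (ennreal (psi x))) \<in> borel_measurable borel" by measurable
  then show ?thesis by (simp add: psi_bounds)
qed

text \<open>The product law from \<open>markov\<close> lets the future path be integrated out first.
  The remaining variable is translated by \<open>x + \<mu> * s\<close> to have the law of the
  position.\<close>

lemma markov_nn_integral:
  assumes "0 < s" and [measurable]: "h \<in> borel_measurable (borel \<Otimes>\<^sub>M path_space)"
  shows "(\<integral>\<^sup>+\<omega>. h (X x s \<omega>, increment_path B s \<omega>) \<partial>M) =
    (\<integral>\<^sup>+y. ennreal (normal_density (\<mu> * s) (sqrt s) (y - x)) * (\<integral>\<^sup>+p. h (y, p) \<partial>wiener) \<partial>lborel)"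
proof -
  interpret W: prob_space wiener by (rule prob_space_wiener)
  have [measurable]: "random_variable borel (\<lambda>\<omega>. B s \<omega> - B 0 \<omega>)"
    using assms by auto
  have [measurable]: "increment_path B s \<in> M \<rightarrow>\<^sub>M path_space"
    using assms by (intro measurable_increment_path) auto
  define H where "H y = (\<integral>\<^sup>+p. h (y, p) \<partial>wiener)" for y
  have H[measurable]: "H \<in> borel_measurable borel"
    unfolding H_def by (rule W.borel_measurable_nn_integral) (simp cong: measurable_cong_sets)
  define c where "c = x + \<mu> * s"
  have sh[measurable]: "(\<lambda>z. h (c + fst z, snd z)) \<in> borel_measurable (borel \<Otimes>\<^sub>M path_space)"
    by measurable
  have "(\<integral>\<^sup>+\<omega>. h (X x s \<omega>, increment_path B s \<omega>) \<partial>M) =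
      (\<integral>\<^sup>+\<omega>. h (c + (B s \<omega> - B 0 \<omega>), increment_path B s \<omega>) \<partial>M)"
  proof (rule nn_integral_cong_AE)
    show "AE \<omega> in M. h (X x s \<omega>, increment_path B s \<omega>) = h (c + (B s \<omega> - B 0 \<omega>), increment_path B s \<omega>)"
      using start by eventually_elim (simp add: brownian_with_drift_def c_def algebra_simps)
  qed
  also have "\<dots> = (\<integral>\<^sup>+z. h (c + fst z, snd z) \<partial>distr M (borel \<Otimes>\<^sub>M path_space) (\<lambda>\<omega>. (B s \<omega> - B 0 \<omega>, increment_path B s \<omega>)))"
    by (subst nn_integral_distr) auto
  also have "\<dots> = (\<integral>\<^sup>+z. h (c + fst z, snd z) \<partial>(density lborel (normal_density 0 (sqrt s)) \<Otimes>\<^sub>M wiener))"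
    by (simp only: markov[OF \<open>0 < s\<close>])
  also have "\<dots> = (\<integral>\<^sup>+b. H (c + b) \<partial>density lborel (normal_density 0 (sqrt s)))"
    unfolding H_def using sh
    by (subst W.nn_integral_fst[symmetric]) (auto cong: measurable_cong_sets sets_pair_measure_cong)
  also have "\<dots> = (\<integral>\<^sup>+b. ennreal (normal_density 0 (sqrt s) b) * H (c + b) \<partial>lborel)"
    by (subst nn_integral_density) auto
  also have "\<dots> = (\<integral>\<^sup>+y. ennreal (normal_density 0 (sqrt s) (- c + y)) * H y \<partial>lborel)"
    by (subst nn_integral_real_affine[where c=1 and t="-c"]) auto
  also have "\<dots> = (\<integral>\<^sup>+y. ennreal (normal_density (\<mu> * s) (sqrt s) (y - x)) * H y \<partial>lborel)"
    by (simp add: normal_density_def c_def algebra_simps)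
  finally show ?thesis unfolding H_def .
qed

text \<open>Expectation and time integral are exchanged. At a fixed time the integrand depends on
  the position only, and integrating the transition density over time gives
  \<open>green\<close>.\<close>

lemma nn_integral_A: "(\<integral>\<^sup>+\<omega>. A x \<omega> \<partial>M) = (\<integral>\<^sup>+y. ennreal (green \<mu> (y - x)) * ennreal (f y) \<partial>lborel)"
proof -
  interpret W: prob_space wiener by (rule prob_space_wiener)
  interpret LM: pair_sigma_finite lborel M ..
  have "(\<integral>\<^sup>+\<omega>. A x \<omega> \<partial>M) = (\<integral>\<^sup>+s. (\<integral>\<^sup>+\<omega>. ennreal (f (X x s \<omega>)) * indicator {0..} s \<partial>M) \<partial>lborel)"
    unfolding perpetual_integral_def using measurable_fX_joint[of x]
    by (intro LM.Fubini') (simp add: case_prod_beta)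
  also have "\<dots> = (\<integral>\<^sup>+s\<in>{0<..}. (\<integral>\<^sup>+y. ennreal (normal_density (\<mu> * s) (sqrt s) (y - x)) * ennreal (f y) \<partial>lborel) \<partial>lborel)"
  proof (rule nn_integral_cong_AE)
    show "AE s in lborel. (\<integral>\<^sup>+\<omega>. ennreal (f (X x s \<omega>)) * indicator {0..} s \<partial>M) =
        (\<integral>\<^sup>+y. ennreal (normal_density (\<mu> * s) (sqrt s) (y - x)) * ennreal (f y) \<partial>lborel) * indicator {0<..} s"
      using AE_lborel_singleton[of 0]
    proof eventually_elim
      fix s :: real assume "s \<noteq> 0"
      then consider "0 < s" | "s < 0" by linarith
      then show "(\<integral>\<^sup>+\<omega>. ennreal (f (X x s \<omega>)) * indicator {0..} s \<partial>M) =
        (\<integral>\<^sup>+y. ennreal (normal_density (\<mu> * s) (sqrt s) (y - x)) * ennreal (f y) \<partial>lborel) * indicator {0<..} s"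
      proof cases
        case 1
        have "(\<lambda>z. ennreal (f (fst z))) \<in> borel_measurable (borel \<Otimes>\<^sub>M path_space)" by measurable
        from markov_nn_integral[OF 1 this, of x] 1 show ?thesis
          by (simp add: W.emeasure_space_1)
      qed auto
    qed
  qed
  also have "\<dots> = (\<integral>\<^sup>+y. ennreal (green \<mu> (y - x)) * ennreal (f y) \<partial>lborel)"
    by (rule nn_integral_green[OF \<mu>]) simp
  finally show ?thesis .
qed

text \<open>Kac's identity, the integrated form of the differential equation.\<close>

lemma psi_resolvent:
  assumes fin: "AE \<omega> in M. A x \<omega> < \<infinity>"
  shows "ennreal (1 - psi x) = (\<integral>\<^sup>+y. ennreal (green \<mu> (y - x)) * ennreal (\<gamma> * f y * psi y) \<partial>lborel)"
proof -
  interpret W: prob_space wiener by (rule prob_space_wiener)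
  interpret LM: pair_sigma_finite lborel M ..
  let ?T = "\<lambda>s \<omega>. exp_neg (\<gamma> * (\<integral>\<^sup>+t\<in>{s..}. f (X x t \<omega>) \<partial>lborel))"
  have "ennreal (1 - psi x) = ennreal (LINT \<omega>|M. 1 - exp_neg (\<gamma> * A x \<omega>))"
    unfolding Psi_def
    by (subst Bochner_Integration.integral_diff)
       (auto intro!: integrable_const_bound[where B=1] simp: exp_neg_nonneg exp_neg_le_1 prob_space)
  also have "\<dots> = (\<integral>\<^sup>+\<omega>. ennreal (1 - exp_neg (\<gamma> * A x \<omega>)) \<partial>M)"
    by (intro nn_integral_eq_integral[symmetric] Bochner_Integration.integrable_diff integrable_const_bound[where B=1])
       (auto simp: exp_neg_nonneg exp_neg_le_1)
  also have "\<dots> = (\<integral>\<^sup>+\<omega>. (\<integral>\<^sup>+s\<in>{0..}. ennreal (\<gamma> * f (X x s \<omega>)) * ennreal (?T s \<omega>) \<partial>lborel) \<partial>M)"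
  proof (rule nn_integral_cong_AE)
    show "AE \<omega> in M. ennreal (1 - exp_neg (\<gamma> * A x \<omega>)) =
        (\<integral>\<^sup>+s\<in>{0..}. ennreal (\<gamma> * f (X x s \<omega>)) * ennreal (?T s \<omega>) \<partial>lborel)"
      using fin AE_space
    proof eventually_elim
      fix \<omega> assume fin: "A x \<omega> < \<infinity>" and \<omega>: "\<omega> \<in> space M"
      \<comment> \<open>Measurability in time is available only for the integrand cut off at
        negative times; the integrals over nonnegative times do not change.\<close>
      let ?g = "\<lambda>s. f (X x s \<omega>) * indicator {0..} s"
      have tail: "(\<integral>\<^sup>+t\<in>{s..}. ?g t \<partial>lborel) = (\<integral>\<^sup>+t\<in>{s..}. f (X x t \<omega>) \<partial>lborel)" if "0 \<le> s" for s
        using that by (intro nn_integral_cong) (auto simp: indicator_def)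
      have A: "(\<integral>\<^sup>+t\<in>{0..}. ?g t \<partial>lborel) = A x \<omega>"
        by (simp add: tail perpetual_integral_def)
      have "ennreal (1 - exp_neg (\<gamma> * A x \<omega>)) =
          (\<integral>\<^sup>+s\<in>{0..}. ennreal (\<gamma> * ?g s) * ennreal (exp_neg (\<gamma> * (\<integral>\<^sup>+t\<in>{s..}. ?g t \<partial>lborel))) \<partial>lborel)"
        using nn_integral_exp_tail[OF measurable_fX[OF \<omega>, of x] _ \<gamma>] fin f_nonneg by (simp add: A)
      also have "\<dots> = (\<integral>\<^sup>+s\<in>{0..}. ennreal (\<gamma> * f (X x s \<omega>)) * ennreal (?T s \<omega>) \<partial>lborel)"
      proof (rule nn_integral_cong)
        fix s
        show "ennreal (\<gamma> * ?g s) * ennreal (exp_neg (\<gamma> * (\<integral>\<^sup>+t\<in>{s..}. ?g t \<partial>lborel))) * indicator {0..} s =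
            ennreal (\<gamma> * f (X x s \<omega>)) * ennreal (?T s \<omega>) * indicator {0..} s"
          by (cases "0 \<le> s") (simp_all add: tail)
      qed
      finally show "ennreal (1 - exp_neg (\<gamma> * A x \<omega>)) =
        (\<integral>\<^sup>+s\<in>{0..}. ennreal (\<gamma> * f (X x s \<omega>)) * ennreal (?T s \<omega>) \<partial>lborel)" .
    qed
  qed
  also have "\<dots> = (\<integral>\<^sup>+s. (\<integral>\<^sup>+\<omega>. ennreal (\<gamma> * f (X x s \<omega>)) * ennreal (?T s \<omega>) * indicator {0..} s \<partial>M) \<partial>lborel)"
  proof (rule LM.Fubini')
    \<comment> \<open>Joint measurability is shown for this variant, whose tail integral uses the
      path at nonnegative times only. It coincides with the integrand, because both vanish for
      \<open>s < 0\<close>.\<close>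
    define F where "F s \<omega> = ennreal \<gamma> * (ennreal (f (X x s \<omega>)) * indicator {0..} s) *
        ennreal (exp_neg (\<gamma> * (\<integral>\<^sup>+t. ennreal (f (X x t \<omega>)) * indicator {0..} t * of_bool (s \<le> t) \<partial>lborel)))" for s \<omega>
    have 1: "(\<lambda>z. (snd z, snd (fst z))) \<in> (lborel \<Otimes>\<^sub>M M) \<Otimes>\<^sub>M lborel \<rightarrow>\<^sub>M lborel \<Otimes>\<^sub>M M" by measurable
    have [measurable]: "(\<lambda>z. ennreal (f (X x (snd z) (snd (fst z)))) * indicator {0..} (snd z)) \<in> borel_measurable ((lborel \<Otimes>\<^sub>M M) \<Otimes>\<^sub>M lborel)"
      using measurable_compose[OF 1 measurable_fX_joint[of x]] by simp
    have [measurable]: "Measurable.pred ((lborel \<Otimes>\<^sub>M M) \<Otimes>\<^sub>M lborel) (\<lambda>z. fst (fst z) \<le> (snd z :: real))"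
      by measurable
    have "(\<lambda>z. \<integral>\<^sup>+t. ennreal (f (X x t (snd z))) * indicator {0..} t * of_bool (fst z \<le> t) \<partial>lborel) \<in> borel_measurable (lborel \<Otimes>\<^sub>M M)"
      by (rule lborel.borel_measurable_nn_integral) (simp add: case_prod_beta)
    then have F: "(\<lambda>z. F (fst z) (snd z)) \<in> borel_measurable (lborel \<Otimes>\<^sub>M M)"
      unfolding F_def by measurable
    have tail: "(\<integral>\<^sup>+t. ennreal (f (X x t \<omega>)) * indicator {0..} t * of_bool (s \<le> t) \<partial>lborel) = (\<integral>\<^sup>+t\<in>{s..}. f (X x t \<omega>) \<partial>lborel)"
      if "0 \<le> s" for s \<omega>
      using that by (intro nn_integral_cong) (auto simp: indicator_def)
    have F_eq: "F s \<omega> =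
        ennreal (\<gamma> * f (X x s \<omega>)) * ennreal (?T s \<omega>) * indicator {0..} s" for s \<omega>
      using \<gamma> f_nonneg by (cases "0 \<le> s") (simp_all add: F_def tail ennreal_mult)
    show "(\<lambda>(s, \<omega>). ennreal (\<gamma> * f (X x s \<omega>)) * ennreal (?T s \<omega>) * indicator {0..} s) \<in> borel_measurable (lborel \<Otimes>\<^sub>M M)"
      using F by (simp only: F_eq case_prod_beta')
  qed
  also have "\<dots> = (\<integral>\<^sup>+s\<in>{0<..}. (\<integral>\<^sup>+y. ennreal (normal_density (\<mu> * s) (sqrt s) (y - x)) * ennreal (\<gamma> * f y * psi y) \<partial>lborel) \<partial>lborel)"
  proof (rule nn_integral_cong_AE)
    show "AE s in lborel. (\<integral>\<^sup>+\<omega>. ennreal (\<gamma> * f (X x s \<omega>)) * ennreal (?T s \<omega>) * indicator {0..} s \<partial>M) =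
        (\<integral>\<^sup>+y. ennreal (normal_density (\<mu> * s) (sqrt s) (y - x)) * ennreal (\<gamma> * f y * psi y) \<partial>lborel) * indicator {0<..} s"
      using AE_lborel_singleton[of 0]
    proof eventually_elim
      fix s :: real assume "s \<noteq> 0"
      then consider "0 < s" | "s < 0" by linarith
      then show "(\<integral>\<^sup>+\<omega>. ennreal (\<gamma> * f (X x s \<omega>)) * ennreal (?T s \<omega>) * indicator {0..} s \<partial>M) =
        (\<integral>\<^sup>+y. ennreal (normal_density (\<mu> * s) (sqrt s) (y - x)) * ennreal (\<gamma> * f y * psi y) \<partial>lborel) * indicator {0<..} s"
      proof cases
        case 1
        define h where "h z = ennreal (\<gamma> * f (fst z)) * ennreal (exp_neg (\<gamma> * occupation \<mu> f (fst z) (snd z)))" for z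
        have h: "h \<in> borel_measurable (borel \<Otimes>\<^sub>M path_space)" unfolding h_def by measurable
        \<comment> \<open>Given that the position at time \<open>s\<close> is \<open>y\<close>, the
          expected discount from the future is \<open>psi y\<close>.\<close>
        have inner: "(\<integral>\<^sup>+p. h (y, p) \<partial>wiener) = ennreal (\<gamma> * f y * psi y)" for y
        proof -
          note [measurable] = measurable_occupation_path
          have "(\<integral>\<^sup>+p. h (y, p) \<partial>wiener) = ennreal (\<gamma> * f y) * ennreal (psi y)"
            unfolding h_def psi_eq_wiener fst_conv snd_conv by (intro nn_integral_cmult) measurable
          then show ?thesis using \<gamma> f_nonneg[of y] psi_bounds[of y] by (simp flip: ennreal_mult)
        qed
        have "(\<integral>\<^sup>+\<omega>. ennreal (\<gamma> * f (X x s \<omega>)) * ennreal (?T s \<omega>) * indicator {0..} s \<partial>M) =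
          (\<integral>\<^sup>+\<omega>. h (X x s \<omega>, increment_path B s \<omega>) \<partial>M)"
          using 1 by (intro nn_integral_cong) (simp add: h_def tail_eq_occupation)
        then show ?thesis
          unfolding markov_nn_integral[OF 1 h] inner using 1 by simp
      qed auto
    qed
  qed
  also have "\<dots> = (\<integral>\<^sup>+y. ennreal (green \<mu> (y - x)) * ennreal (\<gamma> * f y * psi y) \<partial>lborel)"
    by (rule nn_integral_green[OF \<mu>]) measurable
  finally show ?thesis .
qed

end

section \<open>Piecewise continuous functions and tail integrals\<close>

lemma piecewise_continuous_measurable:
  assumes "piecewise_continuous f"
  shows "f \<in> borel_measurable borel"
proof (rule borel_measurable_continuous_countable_exceptions)
  have "{x. \<not> isCont f x} = (\<Union>n::nat. {x \<in> {- real n..real n}. \<not> isCont f x})"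
  proof safe
    fix x assume "\<not> isCont f x"
    moreover obtain n :: nat where "\<bar>x\<bar> \<le> real n" using real_arch_simple by blast
    ultimately show "x \<in> (\<Union>n::nat. {x \<in> {- real n..real n}. \<not> isCont f x})"
      by (auto intro!: exI[of _ n])
  qed
  moreover have "countable {x \<in> {- real n..real n}. \<not> isCont f x}" for n :: nat
    using assms unfolding piecewise_continuous_def by (intro countable_finite) auto
  ultimately show "countable {x. \<not> isCont f x}" by simp
  show "continuous_on (- {x. \<not> isCont f x}) f"
    by (rule continuous_at_imp_continuous_on) auto
qed

text \<open>One-sided limits bound \<open>f\<close> on either side of each point, and bisection
  passes from these local bounds to the compact interval.\<close>

lemma piecewise_continuous_bounded:
  assumes pc: "piecewise_continuous f"
  shows "\<exists>K. \<forall>x\<in>{a..b}. \<bar>f x\<bar> \<le> K"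
proof (cases "a \<le> b")
  case True
  then show ?thesis
  proof (induction rule: Bolzano)
    case (trans a b c)
    then obtain K L where "\<forall>x\<in>{a..b}. \<bar>f x\<bar> \<le> K" "\<forall>x\<in>{b..c}. \<bar>f x\<bar> \<le> L" by blast
    then have "\<forall>x\<in>{a..c}. \<bar>f x\<bar> \<le> max K L"
      by (auto simp: le_max_iff_disj)
    then show ?case by blast
  next
    case (local x)
    obtain l r where "(f \<longlongrightarrow> l) (at_left x)" "(f \<longlongrightarrow> r) (at_right x)"
      using pc unfolding piecewise_continuous_def by meson
    then have "eventually (\<lambda>y. dist (f y) l < 1) (at_left x)" "eventually (\<lambda>y. dist (f y) r < 1) (at_right x)"
      by (auto dest: tendstoD[where e=1])
    then obtain u v where u: "u < x" "\<And>y. u < y \<Longrightarrow> y < x \<Longrightarrow> dist (f y) l < 1"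
      and v: "x < v" "\<And>y. x < y \<Longrightarrow> y < v \<Longrightarrow> dist (f y) r < 1"
      unfolding eventually_at_left_field eventually_at_right_field by blast
    define K where "K = max \<bar>f x\<bar> (max (\<bar>l\<bar> + 1) (\<bar>r\<bar> + 1))"
    have K: "\<bar>f y\<bar> \<le> K" if "u < y" "y < v" for y
      using u(2)[of y] v(2)[of y] that by (cases y x rule: linorder_cases) (auto simp: K_def dist_real_def)
    have "\<forall>a b. a \<le> x \<and> x \<le> b \<and> b - a < min (x - u) (v - x) \<longrightarrow> (\<exists>K. \<forall>x\<in>{a..b}. \<bar>f x\<bar> \<le> K)"
    proof (intro allI impI exI[of _ K] ballI)
      fix a b y assume "a \<le> x \<and> x \<le> b \<and> b - a < min (x - u) (v - x)" "y \<in> {a..b}"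
      then show "\<bar>f y\<bar> \<le> K" by (intro K) auto
    qed
    then show ?case
      using u v by (intro exI[of _ "min (x - u) (v - x)"]) auto
  qed
qed auto

lemma piecewise_continuous_set_integrable:
  assumes "piecewise_continuous f" "integrable_near_infinity f"
  shows "set_integrable lborel {a..} f"
proof -
  have [measurable]: "f \<in> borel_measurable borel"
    by (rule piecewise_continuous_measurable) fact
  obtain c where c: "set_integrable lborel {c..} f"
    using assms(2) by (auto simp: integrable_near_infinity_def)
  obtain K where K: "\<forall>x\<in>{a..c}. \<bar>f x\<bar> \<le> K"
    using piecewise_continuous_bounded[OF assms(1)] by blast
  have "set_integrable lborel {a..c} f"
    unfolding set_integrable_def using K
    by (intro integrableI_bounded_set_indicator[where B=K]) (auto simp: emeasure_lborel_Icc_eq)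
  then have "set_integrable lborel ({a..c} \<union> {c..}) f"
    using c by (intro set_integrable_Un) auto
  then show ?thesis
    by (rule set_integrable_subset) auto
qed

section \<open>Continuity and derivatives of integrals over half-lines\<close>

lemma set_integral_atMost_split:
  fixes g :: "real \<Rightarrow> real"
  assumes "set_integrable lborel {..b} g" "a \<le> u" "u \<le> b"
  shows "g integrable_on {a..b}"
    and "(LINT t:{..u}|lborel. g t) = (LINT t:{..a}|lborel. g t) + integral {a..u} g"
proof -
  have si: "set_integrable lborel S g" if "S \<subseteq> {..b}" "S \<in> sets borel" for S
    using set_integrable_subset[OF assms(1)] that by auto
  have "set_integrable lborel {a..b} g" by (rule si) auto
  then show "g integrable_on {a..b}" by (rule set_borel_integral_eq_integral)
  have "{..u} = {..a} \<union> {a<..u}" using assms by auto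
  then have "(LINT t:{..u}|lborel. g t) = (LINT t:{..a}|lborel. g t) + (LINT t:{a<..u}|lborel. g t)"
    using assms by (simp, intro set_integral_Un si) auto
  also have "(LINT t:{a<..u}|lborel. g t) = integral {a<..u} g"
    using assms by (intro set_borel_integral_eq_integral si) auto
  also have "\<dots> = integral {a..u} g"
    by (rule integral_subset_negligible) (auto intro: negligible_subset[of "{a}"])
  finally show "(LINT t:{..u}|lborel. g t) = (LINT t:{..a}|lborel. g t) + integral {a..u} g" .
qed

lemma continuous_set_integral_atMost:
  fixes g :: "real \<Rightarrow> real"
  assumes "\<And>b. set_integrable lborel {..b} g"
  shows "isCont (\<lambda>u. LINT t:{..u}|lborel. g t) x"
proof -
  note split = set_integral_atMost_split[OF assms]
  have "continuous_on {x - 1..x + 1} (\<lambda>u. integral {x - 1..u} g)"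
    by (intro indefinite_integral_continuous_1 split) auto
  then have "continuous_on {x - 1..x + 1} (\<lambda>u. (LINT t:{..x - 1}|lborel. g t) + integral {x - 1..u} g)"
    by (intro continuous_intros)
  then have "continuous_on {x - 1..x + 1} (\<lambda>u. LINT t:{..u}|lborel. g t)"
    by (rule continuous_on_eq) (auto intro!: split(2)[of "x - 1" _ "x + 1", symmetric])
  then show ?thesis
    by (rule continuous_on_interior) simp
qed

text \<open>Meant for the integrand \<open>k\<close>, which may jump where \<open>f\<close> does, so
  only continuity at \<open>x\<close> is assumed. Splitting at \<open>x - 1\<close> isolates a
  constant and leaves an integral over a compact interval.\<close>

lemma DERIV_set_integral_atMost:
  fixes g :: "real \<Rightarrow> real"
  assumes si: "\<And>b. set_integrable lborel {..b} g" and "isCont g x"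
  shows "((\<lambda>u. LINT t:{..u}|lborel. g t) has_real_derivative g x) (at x)"
proof -
  note split = set_integral_atMost_split[OF si]
  have "((\<lambda>u. integral {x - 1..u} g) has_vector_derivative g x) (at x within ({x - 1..x + 1} - {}))"
    using \<open>isCont g x\<close>
    by (intro integral_has_vector_derivative_continuous_at split) (auto intro: continuous_at_imp_continuous_within)
  then have "((\<lambda>u. integral {x - 1..u} g) has_real_derivative g x) (at x within {x - 1..x + 1})"
    by (simp add: has_real_derivative_iff_has_vector_derivative)
  then have "((\<lambda>u. (LINT t:{..x - 1}|lborel. g t) + integral {x - 1..u} g) has_real_derivative g x)
      (at x within {x - 1..x + 1})"
    by (auto intro!: derivative_eq_intros)
  then have "((\<lambda>u. LINT t:{..u}|lborel. g t) has_real_derivative g x) (at x within {x - 1..x + 1})"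
    by (rule has_field_derivative_transform_within[where d=1])
       (auto simp: dist_real_def intro!: split(2)[of "x - 1" _ "x + 1", symmetric])
  then show ?thesis by (simp add: at_within_Icc_at)
qed

lemma DERIV_set_integral_atLeast:
  fixes g :: "real \<Rightarrow> real"
  assumes si: "\<And>a. set_integrable lborel {a..} g" and cont: "continuous_on UNIV g"
  shows "((\<lambda>u. LINT t:{u..}|lborel. g t) has_real_derivative - g x) (at x)"
proof -
  have si': "set_integrable lborel S g" if "S \<subseteq> {a..}" "S \<in> sets borel" for S a
    using set_integrable_subset[OF si[of a]] that by auto
  have eq: "(LINT t:{u..}|lborel. g t) = (LINT t:{x - 1..}|lborel. g t) - integral {x - 1..u} g"
    if "x - 1 \<le> u" for u
  proof -
    have "{x - 1..} = {x - 1..<u} \<union> {u..}" using that by auto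
    then have "(LINT t:{x - 1..}|lborel. g t) = (LINT t:{x - 1..<u}|lborel. g t) + (LINT t:{u..}|lborel. g t)"
      using that by (simp, intro set_integral_Un si'[of _ "x - 1"]) auto
    also have "(LINT t:{x - 1..<u}|lborel. g t) = integral {x - 1..<u} g"
      by (intro set_borel_integral_eq_integral si'[of _ "x - 1"]) auto
    also have "\<dots> = integral {x - 1..u} g"
      by (rule integral_subset_negligible) (auto intro: negligible_subset[of "{u}"])
    finally show ?thesis by simp
  qed
  have "((\<lambda>u. integral {x - 1..u} g) has_real_derivative g x) (at x within {x - 1..x + 1})"
    by (intro integral_has_real_derivative continuous_on_subset[OF cont]) auto
  then have "((\<lambda>u. (LINT t:{x - 1..}|lborel. g t) - integral {x - 1..u} g) has_real_derivative - g x)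
      (at x within {x - 1..x + 1})"
    by (auto intro!: derivative_eq_intros)
  then have "((\<lambda>u. LINT t:{u..}|lborel. g t) has_real_derivative - g x) (at x within {x - 1..x + 1})"
    by (rule has_field_derivative_transform_within[where d=1])
       (auto simp: dist_real_def intro!: eq[symmetric])
  then show ?thesis by (simp add: at_within_Icc_at)
qed

text \<open>The case of an infinite limit matters: truncated perpetual integrals are passed to the
  limit before the limit is known to be finite.\<close>

lemma tendsto_exp_neg:
  assumes "(a \<longlongrightarrow> l) F"
  shows "((\<lambda>n. exp_neg (a n)) \<longlongrightarrow> exp_neg l) F"
proof (cases "l = \<infinity>")
  case False
  then have "eventually (\<lambda>n. a n < \<infinity>) F"
    using order_tendstoD(2)[OF assms, of \<infinity>] by (simp add: less_top)
  then have "eventually (\<lambda>n. exp (- enn2real (a n)) = exp_neg (a n)) F"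
    by eventually_elim (auto simp: exp_neg_def)
  moreover have "((\<lambda>n. enn2real (a n)) \<longlongrightarrow> enn2real l) F"
    using assms False by (intro tendsto_enn2real) (auto simp: less_top)
  then have "((\<lambda>n. exp (- enn2real (a n))) \<longlongrightarrow> exp_neg l) F"
    using False by (auto simp: exp_neg_def intro!: tendsto_intros)
  ultimately show ?thesis by (rule Lim_transform_eventually[rotated])
next
  case True
  show ?thesis
  proof (rule tendstoI)
    fix e :: real assume "0 < e"
    define K where "K = max 0 (- ln e)"
    have "exp (- K) \<le> exp (ln e)" by (simp add: K_def)
    then have K: "0 \<le> K" "exp (- K) \<le> e"
      using \<open>0 < e\<close> by (auto simp: K_def)
    have "eventually (\<lambda>n. ennreal K < a n) F"
      using order_tendstoD(1)[OF assms, of "ennreal K"] True by simp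
    then show "eventually (\<lambda>n. dist (exp_neg (a n)) (exp_neg l) < e) F"
    proof eventually_elim
      fix n assume n: "ennreal K < a n"
      show "dist (exp_neg (a n)) (exp_neg l) < e"
      proof (cases "a n")
        case (real r)
        then have "K < r" using n K by (simp add: ennreal_less_iff)
        then have "exp (- r) < e" using K(2) by (smt (verit) exp_less_mono)
        then show ?thesis using real True by (simp add: exp_neg_def dist_real_def)
      qed (use True \<open>0 < e\<close> in \<open>simp add: exp_neg_def\<close>)
    qed
  qed
qed

section \<open>Finiteness of the perpetual integral and the differential equation\<close>

lemma green_nonneg: "0 < \<mu> \<Longrightarrow> 0 \<le> green \<mu> z"
  by (simp add: green_def)

lemma green_le: "0 < \<mu> \<Longrightarrow> green \<mu> z \<le> 1 / \<mu>"
  by (auto simp: green_def divide_right_mono mult_nonneg_nonpos)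

text \<open>The integrand separates into a factor in \<open>t\<close> and a factor in
  \<open>y\<close>, on the region where \<open>t\<close> exceeds both \<open>x\<close> and
  \<open>y\<close>. The starting point thus survives only as a limit of integration, in which one
  can differentiate.\<close>

lemma green_eq_integral:
  assumes "0 < \<mu>"
  shows "ennreal (green \<mu> (y - x)) =
    (\<integral>\<^sup>+t. ennreal (2 * exp (- 2 * \<mu> * t)) * ennreal (exp (2 * \<mu> * y)) * indicator {x..} t * indicator {..t} y \<partial>lborel)"
proof -
  define F where "F t = - exp (- 2 * \<mu> * t) * exp (2 * \<mu> * y) / \<mu>" for t
  have "(\<integral>\<^sup>+t. ennreal (2 * exp (- 2 * \<mu> * t)) * ennreal (exp (2 * \<mu> * y)) * indicator {x..} t * indicator {..t} y \<partial>lborel) =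
      (\<integral>\<^sup>+t. ennreal (2 * exp (- 2 * \<mu> * t) * exp (2 * \<mu> * y)) * indicator {max x y..} t \<partial>lborel)"
    by (intro nn_integral_cong) (auto simp: indicator_def ennreal_mult)
  also have "\<dots> = ennreal (0 - F (max x y))"
  proof (rule nn_integral_FTC_atLeast)
    show "(F has_real_derivative 2 * exp (- 2 * \<mu> * t) * exp (2 * \<mu> * y)) (at t)" for t
      unfolding F_def using assms by (auto intro!: derivative_eq_intros simp: field_simps)
    show "(F \<longlongrightarrow> 0) at_top"
      unfolding F_def using assms by real_asymp
  qed auto
  also have "0 - F (max x y) = green \<mu> (y - x)"
    by (auto simp: F_def green_def max_def algebra_simps simp flip: exp_add)
  finally show ?thesis by simp
qed

context perpetual
begin

lemma AE_A_finite_of_integrable: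
  assumes "integrable lborel f"
  shows "AE \<omega> in M. A x \<omega> < \<infinity>"
proof -
  have "(\<integral>\<^sup>+\<omega>. A x \<omega> \<partial>M) \<le> (\<integral>\<^sup>+y. ennreal (1 / \<mu>) * ennreal (f y) \<partial>lborel)"
    unfolding nn_integral_A by (intro nn_integral_mono mult_right_mono ennreal_leI green_le \<mu>) auto
  also have "\<dots> = ennreal (1 / \<mu>) * (\<integral>\<^sup>+y. f y \<partial>lborel)"
    by (intro nn_integral_cmult) auto
  also have "\<dots> = ennreal (1 / \<mu>) * ennreal (LINT y|lborel. f y)"
    using assms f_nonneg by (subst nn_integral_eq_integral) auto
  also have "\<dots> < \<infinity>" by (simp add: ennreal_mult_less_top)
  finally show ?thesis
    using nn_integral_PInf_AE[of "A x" M] by (auto simp: less_top)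
qed

text \<open>The resolvent integral is split at \<open>x\<close>. To the right, \<open>green\<close>
  is at most \<open>1 / \<mu>\<close> and \<open>psi\<close> at most 1. To the left, the Green
  function from \<open>y\<close> is that from \<open>x\<close> times the probability of ever
  descending from \<open>y\<close> to \<open>x\<close>, and the integral from \<open>x\<close> is
  \<open>1 - psi x\<close>, at most 1. No size of \<open>f\<close> to the left of \<open>x\<close>
  enters.\<close>

lemma psi_tail_bound:
  assumes fin: "\<And>x. AE \<omega> in M. A x \<omega> < \<infinity>" and si: "set_integrable lborel {x..} f" and "x \<le> y"
  shows "1 - psi y \<le> \<gamma> / \<mu> * (LINT z:{x..}|lborel. f z) + exp (- 2 * \<mu> * (y - x))"
proof -
  define k where "k z = \<gamma> * f z * psi z" for z
  have k: "0 \<le> k z" "k z \<le> \<gamma> * f z" for z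
    using \<gamma> f_nonneg[of z] psi_bounds[of z] by (auto simp: k_def mult_left_le)
  have [measurable]: "k \<in> borel_measurable borel" unfolding k_def by measurable
  have "ennreal (1 - psi y) = (\<integral>\<^sup>+z. ennreal (green \<mu> (z - y)) * ennreal (k z) \<partial>lborel)"
    unfolding k_def by (rule psi_resolvent[OF fin])
  also have "\<dots> \<le> (\<integral>\<^sup>+z. ennreal (\<gamma> / \<mu>) * ennreal (indicator {x..} z *\<^sub>R f z) +
      ennreal (exp (- 2 * \<mu> * (y - x))) * (ennreal (green \<mu> (z - x)) * ennreal (k z)) \<partial>lborel)"
  proof (rule nn_integral_mono)
    fix z
    show "ennreal (green \<mu> (z - y)) * ennreal (k z) \<le> ennreal (\<gamma> / \<mu>) * ennreal (indicator {x..} z *\<^sub>R f z) +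
      ennreal (exp (- 2 * \<mu> * (y - x))) * (ennreal (green \<mu> (z - x)) * ennreal (k z))"
    proof (cases "x \<le> z")
      case True
      have "green \<mu> (z - y) * k z \<le> 1 / \<mu> * (\<gamma> * f z)"
        using k[of z] \<mu> by (intro mult_mono green_le) auto
      then have "ennreal (green \<mu> (z - y)) * ennreal (k z) \<le> ennreal (\<gamma> / \<mu>) * ennreal (indicator {x..} z *\<^sub>R f z)"
        using True k[of z] \<mu> \<gamma> f_nonneg[of z] by (simp add: green_nonneg flip: ennreal_mult)
      then show ?thesis by (rule order_trans) simp
    next
      case False
      then have "green \<mu> (z - y) = exp (- 2 * \<mu> * (y - x)) * green \<mu> (z - x)"
        using \<open>x \<le> y\<close> by (simp add: green_def algebra_simps flip: exp_add)
      then have "ennreal (green \<mu> (z - y)) * ennreal (k z) =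
          ennreal (exp (- 2 * \<mu> * (y - x))) * (ennreal (green \<mu> (z - x)) * ennreal (k z))"
        using green_nonneg[OF \<mu>, of "z - x"] by (simp add: ennreal_mult mult.assoc)
      then show ?thesis by (simp add: add_increasing)
    qed
  qed
  also have "\<dots> = ennreal (\<gamma> / \<mu>) * (\<integral>\<^sup>+z. ennreal (indicator {x..} z *\<^sub>R f z) \<partial>lborel) +
      ennreal (exp (- 2 * \<mu> * (y - x))) * (\<integral>\<^sup>+z. ennreal (green \<mu> (z - x)) * ennreal (k z) \<partial>lborel)"
    by (subst nn_integral_add) (auto simp: nn_integral_cmult)
  also have "(\<integral>\<^sup>+z. ennreal (green \<mu> (z - x)) * ennreal (k z) \<partial>lborel) = ennreal (1 - psi x)"
    unfolding k_def by (rule psi_resolvent[OF fin, symmetric])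
  also have "(\<integral>\<^sup>+z. ennreal (indicator {x..} z *\<^sub>R f z) \<partial>lborel) = ennreal (LINT z:{x..}|lborel. f z)"
    unfolding set_lebesgue_integral_def using si f_nonneg
    by (intro nn_integral_eq_integral) (auto simp: set_integrable_def)
  also have "ennreal (\<gamma> / \<mu>) * ennreal (LINT z:{x..}|lborel. f z) + ennreal (exp (- 2 * \<mu> * (y - x))) * ennreal (1 - psi x)
    = ennreal (\<gamma> / \<mu> * (LINT z:{x..}|lborel. f z) + exp (- 2 * \<mu> * (y - x)) * (1 - psi x))"
  proof -
    have "0 \<le> (LINT z:{x..}|lborel. f z)"
      unfolding set_lebesgue_integral_def using f_nonneg by (intro integral_nonneg_AE) auto
    moreover have "0 \<le> \<gamma> / \<mu>" "0 \<le> 1 - psi x"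
      using \<mu> \<gamma> psi_bounds[of x] by auto
    ultimately show ?thesis
      by (simp only: ennreal_plus ennreal_mult mult_nonneg_nonneg exp_ge_zero)
  qed
  also have "\<dots> \<le> ennreal (\<gamma> / \<mu> * (LINT z:{x..}|lborel. f z) + exp (- 2 * \<mu> * (y - x)))"
    using psi_bounds[of x] by (intro ennreal_leI add_left_mono) (auto simp: mult_left_le)
  finally show ?thesis
  proof (rule ennreal_le_iff[THEN iffD1, rotated])
    have "0 \<le> (LINT z:{x..}|lborel. f z)"
      unfolding set_lebesgue_integral_def using f_nonneg by (intro integral_nonneg_AE) auto
    then show "0 \<le> \<gamma> / \<mu> * (LINT z:{x..}|lborel. f z) + exp (- 2 * \<mu> * (y - x))"
      using \<mu> \<gamma> by simp
  qed
qed

end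

locale piecewise_perpetual = perpetual M B \<mu> \<gamma> f
  for M :: "'a measure" and B :: "real \<Rightarrow> 'a \<Rightarrow> real" and \<mu> \<gamma> f +
  assumes pc: "piecewise_continuous f" and int_inf: "integrable_near_infinity f"
begin

sublocale drift_equation \<mu> \<gamma> f
  by unfold_locales (rule \<mu> \<gamma> f_nonneg pc)+

section \<open>Removal of the truncation and the limit of \<open>psi\<close> at infinity\<close>

lemma set_integrable_f: "set_integrable lborel {a..} f"
  by (rule piecewise_continuous_set_integrable[OF pc int_inf])

text \<open>Integrable over the whole line, since \<open>f\<close> is integrable over every right
  half-line, and increasing to \<open>f\<close> with \<open>n\<close>.\<close>

definition trunc :: "nat \<Rightarrow> real \<Rightarrow> real" where
  "trunc n x = indicator {- real n..} x * f x"

lemma perpetual_trunc: "perpetual M B \<mu> \<gamma> (trunc n)"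
proof unfold_locales
  have "(\<lambda>x. indicator {- real n..} x * f x) \<in> borel_measurable borel" by measurable
  then show "trunc n \<in> borel_measurable borel" by (simp add: trunc_def[abs_def])
  show "0 \<le> trunc n x" for x by (simp add: trunc_def f_nonneg)
qed (rule \<mu> \<gamma>)+

lemma trunc_A_tendsto:
  assumes "\<omega> \<in> space M"
  shows "(\<lambda>n. perpetual_integral B \<mu> (trunc n) x \<omega>) \<longlonglongrightarrow> A x \<omega>"
  unfolding perpetual_integral_def
proof (rule nn_integral_LIMSEQ)
  show "incseq (\<lambda>n s. ennreal (trunc n (X x s \<omega>)) * indicator {0..} s)"
    using f_nonneg by (auto simp: incseq_def le_fun_def trunc_def indicator_def)
  show "(\<lambda>s. ennreal (trunc n (X x s \<omega>)) * indicator {0..} s) \<in> borel_measurable lborel" for n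
  proof -
    interpret T: perpetual M B \<mu> \<gamma> "trunc n" by (rule perpetual_trunc)
    have [measurable]: "(\<lambda>s. trunc n (X x s \<omega>) * indicator {0..} s) \<in> borel_measurable borel"
      by (rule T.measurable_fX[OF assms])
    have "(\<lambda>s. ennreal (trunc n (X x s \<omega>) * indicator {0..} s)) \<in> borel_measurable lborel" by measurable
    then show ?thesis
      by (rule measurable_cong[THEN iffD1, rotated]) (auto simp: indicator_def)
  qed
  show "(\<lambda>n. ennreal (trunc n (X x s \<omega>)) * indicator {0..} s) \<longlonglongrightarrow> ennreal (f (X x s \<omega>)) * indicator {0..} s" for s
  proof (rule tendsto_eventually)
    obtain N :: nat where N: "- X x s \<omega> \<le> real N" using real_arch_simple by blast
    show "eventually (\<lambda>n. ennreal (trunc n (X x s \<omega>)) * indicator {0..} s = ennreal (f (X x s \<omega>)) * indicator {0..} s) sequentially"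
      using eventually_ge_at_top[of N]
    proof eventually_elim
      fix n assume "N \<le> n"
      then have "- real n \<le> X x s \<omega>" using N by linarith
      then show "ennreal (trunc n (X x s \<omega>)) * indicator {0..} s = ennreal (f (X x s \<omega>)) * indicator {0..} s"
        by (simp add: trunc_def)
    qed
  qed
qed

lemma psi_trunc_tendsto: "(\<lambda>n. Psi M B \<mu> \<gamma> (trunc n) x) \<longlonglongrightarrow> psi x"
  unfolding Psi_def
proof (rule integral_dominated_convergence[where w="\<lambda>_. 1"])
  show "AE \<omega> in M. (\<lambda>n. exp_neg (\<gamma> * perpetual_integral B \<mu> (trunc n) x \<omega>)) \<longlonglongrightarrow> exp_neg (\<gamma> * A x \<omega>)"
    by (intro AE_I2 tendsto_exp_neg ennreal_tendsto_cmult trunc_A_tendsto) auto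
  show "(\<lambda>\<omega>. exp_neg (\<gamma> * perpetual_integral B \<mu> (trunc n) x \<omega>)) \<in> borel_measurable M" for n
  proof -
    interpret T: perpetual M B \<mu> \<gamma> "trunc n" by (rule perpetual_trunc)
    show ?thesis by measurable
  qed
qed (auto simp: exp_neg_nonneg exp_neg_le_1)

text \<open>The bound is uniform in the truncation, so it survives the limit although finiteness of
  \<open>A\<close> is not yet known.\<close>

lemma psi_bound:
  assumes "x \<le> y"
  shows "1 - psi y \<le> \<gamma> / \<mu> * (LINT z:{x..}|lborel. f z) + exp (- 2 * \<mu> * (y - x))"
proof (rule tendsto_upperbound)
  show "(\<lambda>n. 1 - Psi M B \<mu> \<gamma> (trunc n) y) \<longlonglongrightarrow> 1 - psi y"
    by (intro tendsto_intros psi_trunc_tendsto)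
  show "eventually (\<lambda>n. 1 - Psi M B \<mu> \<gamma> (trunc n) y \<le>
      \<gamma> / \<mu> * (LINT z:{x..}|lborel. f z) + exp (- 2 * \<mu> * (y - x))) sequentially"
  proof (rule always_eventually, rule allI)
    fix n
    interpret T: perpetual M B \<mu> \<gamma> "trunc n" by (rule perpetual_trunc)
    have int: "integrable lborel (trunc n)"
      using set_integrable_f[of "- real n"] by (simp add: set_integrable_def trunc_def[abs_def])
    have si: "set_integrable lborel {x..} (trunc n)"
      unfolding set_integrable_def using int by (intro integrable_mult_indicator) auto
    have "1 - Psi M B \<mu> \<gamma> (trunc n) y \<le>
        \<gamma> / \<mu> * (LINT z:{x..}|lborel. trunc n z) + exp (- 2 * \<mu> * (y - x))"
      by (rule T.psi_tail_bound[OF T.AE_A_finite_of_integrable[OF int] si \<open>x \<le> y\<close>])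
    also have "(LINT z:{x..}|lborel. trunc n z) \<le> (LINT z:{x..}|lborel. f z)"
      using f_nonneg by (intro set_integral_mono si set_integrable_f) (auto simp: trunc_def indicator_def)
    then have "\<gamma> / \<mu> * (LINT z:{x..}|lborel. trunc n z) + exp (- 2 * \<mu> * (y - x)) \<le>
        \<gamma> / \<mu> * (LINT z:{x..}|lborel. f z) + exp (- 2 * \<mu> * (y - x))"
      using \<mu> \<gamma> by (intro add_right_mono mult_left_mono) auto
    finally show "1 - Psi M B \<mu> \<gamma> (trunc n) y \<le>
      \<gamma> / \<mu> * (LINT z:{x..}|lborel. f z) + exp (- 2 * \<mu> * (y - x))" .
  qed
qed auto

lemma psi_tendsto_1: "(psi \<longlongrightarrow> 1) at_top"
proof (rule tendsto_sandwich)
  \<comment> \<open>The bound is used with \<open>x\<close> chosen as \<open>y / 2\<close>, so that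
    the tail of \<open>f\<close> and the exponential both vanish. The cut-off makes the function
    integrable over the line without affecting tails from nonnegative points.\<close>
  let ?g = "\<lambda>t. indicator {0..} t * f t"
  let ?L = "\<lambda>y. LINT z:{y / 2..}|lborel. ?g z"
  have "integrable lborel ?g"
    using set_integrable_f[of 0] by (simp add: set_integrable_def)
  then have "((\<lambda>x. LINT z:{x..}|lborel. ?g z) \<longlongrightarrow> 0) at_top"
    by (rule tendsto_integral_tail_0)
  moreover have "filterlim (\<lambda>y::real. y / 2) at_top at_top" by real_asymp
  ultimately have L: "(?L \<longlongrightarrow> 0) at_top"
    by (rule filterlim_compose)
  have "((\<lambda>y. exp (- 2 * \<mu> * (y - y / 2))) \<longlongrightarrow> 0) at_top"
    using \<mu> by real_asymp
  then have "((\<lambda>y. 1 - (\<gamma> / \<mu> * ?L y + exp (- 2 * \<mu> * (y - y / 2)))) \<longlongrightarrow> 1 - (\<gamma> / \<mu> * 0 + 0)) at_top"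
    by (intro tendsto_diff tendsto_add tendsto_mult tendsto_const L)
  then show "((\<lambda>y. 1 - (\<gamma> / \<mu> * ?L y + exp (- 2 * \<mu> * (y - y / 2)))) \<longlongrightarrow> 1) at_top"
    by (simp only: mult_zero_right add_0_right diff_zero)
  show "eventually (\<lambda>y. 1 - (\<gamma> / \<mu> * ?L y + exp (- 2 * \<mu> * (y - y / 2))) \<le> psi y) at_top"
    using eventually_ge_at_top[of 0]
  proof eventually_elim
    fix y :: real assume "0 \<le> y"
    then have "?L y = (LINT z:{y / 2..}|lborel. f z)"
      unfolding set_lebesgue_integral_def by (intro Bochner_Integration.integral_cong) (auto simp: indicator_def)
    then show "1 - (\<gamma> / \<mu> * ?L y + exp (- 2 * \<mu> * (y - y / 2))) \<le> psi y"
      using psi_bound[of "y / 2" y] \<open>0 \<le> y\<close> by simp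
  qed
qed (auto simp: psi_bounds)

section \<open>Almost sure finiteness of the perpetual integral\<close>

lemma A_finite_of_tail_finite:
  assumes \<omega>: "\<omega> \<in> space M" and "0 \<le> s"
    and fin: "(\<integral>\<^sup>+t\<in>{s..}. f (X x t \<omega>) \<partial>lborel) < \<infinity>"
  shows "A x \<omega> < \<infinity>"
proof -
  have [measurable]: "(\<lambda>s. f (X x s \<omega>) * indicator {0..} s) \<in> borel_measurable borel"
    by (rule measurable_fX[OF \<omega>])
  \<comment> \<open>Up to time \<open>s\<close> the path stays in a compact set, where
    \<open>f\<close> is bounded, so the initial stretch contributes a finite amount.\<close>
  have "continuous_on {0..s} (\<lambda>t. X x t \<omega>)"
    unfolding brownian_with_drift_def
    by (intro continuous_intros continuous_on_subset[OF continuous_paths[OF \<omega>]]) auto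
  then have "compact ((\<lambda>t. X x t \<omega>) ` {0..s})"
    by (rule compact_continuous_image) simp
  then have "bounded ((\<lambda>t. X x t \<omega>) ` {0..s})"
    by (rule compact_imp_bounded)
  then obtain R where R: "\<forall>y\<in>(\<lambda>t. X x t \<omega>) ` {0..s}. norm y \<le> R"
    unfolding bounded_iff by blast
  obtain K where K: "\<forall>y\<in>{-R..R}. \<bar>f y\<bar> \<le> K"
    using piecewise_continuous_bounded[OF pc] by blast
  have K': "f (X x t \<omega>) \<le> K" if "t \<in> {0..s}" for t
  proof -
    have "\<bar>X x t \<omega>\<bar> \<le> R" using R that by auto
    then have "X x t \<omega> \<in> {-R..R}" by auto
    then have "\<bar>f (X x t \<omega>)\<bar> \<le> K" using K by blast
    then show ?thesis by linarith
  qed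
  have "A x \<omega> \<le> (\<integral>\<^sup>+t. ennreal K * indicator {0..s} t +
      ennreal (f (X x t \<omega>) * indicator {0..} t) * indicator {s..} t \<partial>lborel)"
    unfolding perpetual_integral_def
  proof (rule nn_integral_mono)
    fix t
    show "ennreal (f (X x t \<omega>)) * indicator {0..} t \<le> ennreal K * indicator {0..s} t +
      ennreal (f (X x t \<omega>) * indicator {0..} t) * indicator {s..} t"
      using K'[of t] \<open>0 \<le> s\<close> by (cases "t \<le> s"; cases "0 \<le> t") (auto simp: indicator_def ennreal_leI add_increasing2)
  qed
  also have "\<dots> = ennreal K * emeasure lborel {0..s} + (\<integral>\<^sup>+t. ennreal (f (X x t \<omega>) * indicator {0..} t) * indicator {s..} t \<partial>lborel)"
    by (subst nn_integral_add) (auto simp: nn_integral_cmult_indicator)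
  also have "(\<integral>\<^sup>+t. ennreal (f (X x t \<omega>) * indicator {0..} t) * indicator {s..} t \<partial>lborel) = (\<integral>\<^sup>+t\<in>{s..}. f (X x t \<omega>) \<partial>lborel)"
    using \<open>0 \<le> s\<close> by (intro nn_integral_cong) (auto simp: indicator_def)
  also have "ennreal K * emeasure lborel {0..s} + \<dots> < \<infinity>"
    using fin \<open>0 \<le> s\<close> by (simp add: ennreal_mult_less_top)
  finally show ?thesis .
qed

text \<open>The expectation of \<open>psi\<close> at time \<open>s\<close>, written over a standard
  normal variable. The time then appears only in the argument of \<open>psi\<close>, and one
  majorant serves all times as \<open>s\<close> grows.\<close>

lemma nn_integral_psi_X:
  assumes "0 < s"
  shows "(\<integral>\<^sup>+\<omega>. exp_neg (\<gamma> * (\<integral>\<^sup>+t\<in>{s..}. f (X x t \<omega>) \<partial>lborel)) \<partial>M) =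
    (\<integral>\<^sup>+z. ennreal (std_normal_density z) * ennreal (psi (x + \<mu> * s + sqrt s * z)) \<partial>lborel)"
proof -
  define h where "h z = ennreal (exp_neg (\<gamma> * occupation \<mu> f (fst z) (snd z)))" for z
  have h: "h \<in> borel_measurable (borel \<Otimes>\<^sub>M path_space)" unfolding h_def by measurable
  have "(\<integral>\<^sup>+\<omega>. exp_neg (\<gamma> * (\<integral>\<^sup>+t\<in>{s..}. f (X x t \<omega>) \<partial>lborel)) \<partial>M) =
      (\<integral>\<^sup>+\<omega>. h (X x s \<omega>, increment_path B s \<omega>) \<partial>M)"
    using assms by (intro nn_integral_cong) (simp add: h_def tail_eq_occupation)
  also have "\<dots> = (\<integral>\<^sup>+y. ennreal (normal_density (\<mu> * s) (sqrt s) (y - x)) * ennreal (psi y) \<partial>lborel)"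
    unfolding markov_nn_integral[OF assms h] by (simp add: h_def psi_eq_wiener)
  also have "\<dots> = ennreal (sqrt s) * (\<integral>\<^sup>+z. ennreal (normal_density (\<mu> * s) (sqrt s) (x + \<mu> * s + sqrt s * z - x)) *
      ennreal (psi (x + \<mu> * s + sqrt s * z)) \<partial>lborel)"
    using assms by (subst nn_integral_real_affine[where c="sqrt s" and t="x + \<mu> * s"]) auto
  also have "\<dots> = (\<integral>\<^sup>+z. ennreal (sqrt s) * (ennreal (normal_density (\<mu> * s) (sqrt s) (x + \<mu> * s + sqrt s * z - x)) *
      ennreal (psi (x + \<mu> * s + sqrt s * z))) \<partial>lborel)"
    by (intro nn_integral_cmult[symmetric]) measurable
  also have "\<dots> = (\<integral>\<^sup>+z. ennreal (std_normal_density z) * ennreal (psi (x + \<mu> * s + sqrt s * z)) \<partial>lborel)"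
  proof (rule nn_integral_cong)
    fix z
    have "sqrt s * normal_density (\<mu> * s) (sqrt s) (x + \<mu> * s + sqrt s * z - x) = std_normal_density z"
      using assms by (simp add: normal_density_def std_normal_density_def power_mult_distrib real_sqrt_mult)
    then show "ennreal (sqrt s) * (ennreal (normal_density (\<mu> * s) (sqrt s) (x + \<mu> * s + sqrt s * z - x)) *
      ennreal (psi (x + \<mu> * s + sqrt s * z))) = ennreal (std_normal_density z) * ennreal (psi (x + \<mu> * s + sqrt s * z))"
      using assms by (simp add: mult.assoc[symmetric] flip: ennreal_mult)
  qed
  finally show ?thesis .
qed

text \<open>If \<open>A\<close> is infinite then so are all its tails, whence \<open>E (psi X\<^sub>s) \<le> P (A < \<infinity>)\<close> for
  every \<open>s\<close>.\<close>

lemma AE_A_finite: "AE \<omega> in M. A x \<omega> < \<infinity>"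
proof -
  let ?E = "{\<omega> \<in> space M. A x \<omega> < \<infinity>}"
  have E[measurable]: "?E \<in> sets M" by measurable
  let ?u = "\<lambda>n z. ennreal (std_normal_density z) * ennreal (psi (x + \<mu> * real (Suc n) + sqrt (real (Suc n)) * z))"
  have "(\<lambda>n. \<integral>\<^sup>+z. ?u n z \<partial>lborel) \<longlonglongrightarrow> (\<integral>\<^sup>+z. ennreal (std_normal_density z) \<partial>lborel)"
  proof (rule nn_integral_dominated_convergence[where w="\<lambda>z. ennreal (std_normal_density z)"])
    show "AE z in lborel. ?u n z \<le> ennreal (std_normal_density z)" for n
    proof (rule AE_I2)
      fix z
      have "?u n z \<le> ennreal (std_normal_density z) * 1"
        using psi_bounds by (intro mult_left_mono) auto
      then show "?u n z \<le> ennreal (std_normal_density z)" by simp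
    qed
    show "AE z in lborel. (\<lambda>n. ?u n z) \<longlonglongrightarrow> ennreal (std_normal_density z)"
    proof (rule AE_I2)
      fix z :: real
      \<comment> \<open>For each fixed \<open>z\<close> the linear drift outweighs the square-root
        fluctuation.\<close>
      have "filterlim (\<lambda>n. x + \<mu> * real (Suc n) + sqrt (real (Suc n)) * z) at_top sequentially"
        using \<mu> by real_asymp
      from filterlim_compose[OF psi_tendsto_1 this]
      have "(\<lambda>n. ennreal (psi (x + \<mu> * real (Suc n) + sqrt (real (Suc n)) * z))) \<longlonglongrightarrow> ennreal 1"
        by (rule tendsto_ennrealI)
      then have "(\<lambda>n. ?u n z) \<longlonglongrightarrow> ennreal (std_normal_density z) * ennreal 1"
        by (intro ennreal_tendsto_cmult) auto
      then show "(\<lambda>n. ?u n z) \<longlonglongrightarrow> ennreal (std_normal_density z)" by simp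
    qed
    show "(\<integral>\<^sup>+z. ennreal (std_normal_density z) \<partial>lborel) < \<infinity>"
      using std_normal.emeasure_space_1 by (simp add: emeasure_density)
  qed measurable
  moreover have "(\<integral>\<^sup>+z. ennreal (std_normal_density z) \<partial>lborel) = 1"
    using std_normal.emeasure_space_1 by (simp add: emeasure_density)
  ultimately have lim: "(\<lambda>n. \<integral>\<^sup>+z. ?u n z \<partial>lborel) \<longlonglongrightarrow> 1" by simp
  have "(\<integral>\<^sup>+z. ?u n z \<partial>lborel) \<le> emeasure M ?E" for n
  proof -
    have "(\<integral>\<^sup>+z. ?u n z \<partial>lborel) =
        (\<integral>\<^sup>+\<omega>. exp_neg (\<gamma> * (\<integral>\<^sup>+t\<in>{real (Suc n)..}. f (X x t \<omega>) \<partial>lborel)) \<partial>M)"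
      by (rule nn_integral_psi_X[symmetric]) simp
    also have "\<dots> \<le> (\<integral>\<^sup>+\<omega>. indicator ?E \<omega> \<partial>M)"
    proof (rule nn_integral_mono)
      fix \<omega> assume \<omega>: "\<omega> \<in> space M"
      let ?T = "\<integral>\<^sup>+t\<in>{real (Suc n)..}. f (X x t \<omega>) \<partial>lborel"
      show "ennreal (exp_neg (\<gamma> * ?T)) \<le> indicator ?E \<omega>"
      proof (cases "?T < \<infinity>")
        case True
        then have "A x \<omega> < \<infinity>" using \<omega> by (intro A_finite_of_tail_finite[of \<omega> "real (Suc n)"]) auto
        then show ?thesis using \<omega> by (simp add: exp_neg_le_1)
      next
        case False
        then have "?T = \<infinity>" by (simp add: less_top[symmetric])
        then have "ennreal \<gamma> * ?T = \<infinity>" using \<gamma> by (simp add: ennreal_mult_top)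
        then show ?thesis by (simp add: exp_neg_def)
      qed
    qed
    finally show ?thesis by simp
  qed
  then have "1 \<le> emeasure M ?E"
    by (intro LIMSEQ_le_const2[OF lim]) auto
  then have "1 \<le> prob ?E"
    by (simp add: emeasure_eq_measure)
  then have "prob ?E = 1"
    by (intro antisym prob_le_1)
  then show ?thesis by (simp add: prob_Collect_eq_1)
qed

section \<open>The integral representation of \<open>psi\<close> and the differential
  equation\<close>

definition k :: "real \<Rightarrow> real" where "k y = exp (2 * \<mu> * y) * (\<gamma> * f y * psi y)"

text \<open>This turns out to be half the weighted derivative
  \<open>exp (2 * \<mu> * t) * deriv psi t\<close>.\<close>

definition K :: "real \<Rightarrow> real" where "K t = (LINT y:{..t}|lborel. k y)"

lemma measurable_k[measurable]: "k \<in> borel_measurable borel"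
  unfolding k_def by measurable

lemma k_nonneg: "0 \<le> k y"
  using \<gamma> f_nonneg[of y] psi_bounds[of y] by (simp add: k_def)

text \<open>For \<open>y \<le> t\<close> the weight \<open>exp (2 * \<mu> * y)\<close> is a constant
  multiple of \<open>green \<mu> (y - t)\<close>. The resolvent identity at \<open>t\<close>
  therefore bounds the integral, however fast \<open>f\<close> grows at minus infinity.\<close>

lemma set_integrable_k: "set_integrable lborel {..t} k"
  unfolding set_integrable_def
proof (rule integrableI_nonneg)
  have "(\<integral>\<^sup>+y. ennreal (indicator {..t} y *\<^sub>R k y) \<partial>lborel) \<le>
      (\<integral>\<^sup>+y. ennreal (\<mu> * exp (2 * \<mu> * t)) * (ennreal (green \<mu> (y - t)) * ennreal (\<gamma> * f y * psi y)) \<partial>lborel)"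
  proof (rule nn_integral_mono)
    fix y
    show "ennreal (indicator {..t} y *\<^sub>R k y) \<le>
      ennreal (\<mu> * exp (2 * \<mu> * t)) * (ennreal (green \<mu> (y - t)) * ennreal (\<gamma> * f y * psi y))"
    proof (cases "y \<le> t")
      case True
      then have "exp (2 * \<mu> * y) = \<mu> * exp (2 * \<mu> * t) * green \<mu> (y - t)"
        using \<mu> by (auto simp: green_def algebra_simps simp flip: exp_add)
      then have "k y = (\<mu> * exp (2 * \<mu> * t)) * (green \<mu> (y - t) * (\<gamma> * f y * psi y))"
        by (simp add: k_def mult.assoc)
      then show ?thesis
        using True \<mu> \<gamma> f_nonneg[of y] psi_bounds[of y] green_nonneg[OF \<mu>, of "y - t"] by (simp add: ennreal_mult)
    qed simp
  qed
  also have "\<dots> = ennreal (\<mu> * exp (2 * \<mu> * t)) * (\<integral>\<^sup>+y. ennreal (green \<mu> (y - t)) * ennreal (\<gamma> * f y * psi y) \<partial>lborel)"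
    by (intro nn_integral_cmult) measurable
  also have "\<dots> < \<infinity>"
    unfolding psi_resolvent[OF AE_A_finite, symmetric] by (simp add: ennreal_mult_less_top)
  finally show "(\<integral>\<^sup>+y. ennreal (indicator {..t} y *\<^sub>R k y) \<partial>lborel) < \<infinity>" .
  show "(\<lambda>y. indicator {..t} y *\<^sub>R k y) \<in> borel_measurable lborel" by measurable
  show "AE y in lborel. 0 \<le> indicator {..t} y *\<^sub>R k y"
    using k_nonneg by (intro AE_I2) simp
qed

lemma K_nonneg: "0 \<le> K t"
  unfolding K_def set_lebesgue_integral_def using k_nonneg by (intro integral_nonneg_AE) auto

lemma isCont_K: "isCont K x"
  unfolding K_def by (rule continuous_set_integral_atMost[OF set_integrable_k])

lemma continuous_on_K: "continuous_on S K"
  by (intro continuous_at_imp_continuous_on ballI isCont_K)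

lemma continuous_on_K_exp: "continuous_on S (\<lambda>t. 2 * exp (- 2 * \<mu> * t) * K t)"
  by (intro continuous_intros continuous_on_K)

lemma measurable_K[measurable]: "K \<in> borel_measurable borel"
  by (intro borel_measurable_continuous_onI continuous_on_K)

lemma nn_integral_psi_tail: "ennreal (1 - psi x) = (\<integral>\<^sup>+t\<in>{x..}. 2 * exp (- 2 * \<mu> * t) * K t \<partial>lborel)"
proof -
  have "ennreal (1 - psi x) = (\<integral>\<^sup>+y. ennreal (green \<mu> (y - x)) * ennreal (\<gamma> * f y * psi y) \<partial>lborel)"
    by (rule psi_resolvent[OF AE_A_finite])
  also have "\<dots> = (\<integral>\<^sup>+y. (\<integral>\<^sup>+t. ennreal (2 * exp (- 2 * \<mu> * t)) * ennreal (k y) * indicator {x..} t * of_bool (y \<le> t) \<partial>lborel) \<partial>lborel)"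
  proof (rule nn_integral_cong)
    fix y
    have "ennreal (green \<mu> (y - x)) * ennreal (\<gamma> * f y * psi y) =
      (\<integral>\<^sup>+t. ennreal (2 * exp (- 2 * \<mu> * t)) * ennreal (exp (2 * \<mu> * y)) * indicator {x..} t * indicator {..t} y * ennreal (\<gamma> * f y * psi y) \<partial>lborel)"
      unfolding green_eq_integral[OF \<mu>]
      by (intro nn_integral_multc[symmetric]) (simp add: indicator_def)
    also have "\<dots> = (\<integral>\<^sup>+t. ennreal (2 * exp (- 2 * \<mu> * t)) * ennreal (k y) * indicator {x..} t * of_bool (y \<le> t) \<partial>lborel)"
      using \<gamma> f_nonneg[of y] psi_bounds[of y]
      by (intro nn_integral_cong) (simp add: k_def indicator_def ennreal_mult mult_ac)
    finally show "ennreal (green \<mu> (y - x)) * ennreal (\<gamma> * f y * psi y) =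
      (\<integral>\<^sup>+t. ennreal (2 * exp (- 2 * \<mu> * t)) * ennreal (k y) * indicator {x..} t * of_bool (y \<le> t) \<partial>lborel)" .
  qed
  also have "\<dots> = (\<integral>\<^sup>+t. (\<integral>\<^sup>+y. ennreal (2 * exp (- 2 * \<mu> * t)) * ennreal (k y) * indicator {x..} t * of_bool (y \<le> t) \<partial>lborel) \<partial>lborel)"
    by (rule lborel_pair.Fubini') measurable
  also have "\<dots> = (\<integral>\<^sup>+t\<in>{x..}. 2 * exp (- 2 * \<mu> * t) * K t \<partial>lborel)"
  proof (rule nn_integral_cong)
    fix t
    have K: "(\<integral>\<^sup>+y. ennreal (indicator {..t} y *\<^sub>R k y) \<partial>lborel) = ennreal (K t)"
      unfolding K_def set_lebesgue_integral_def using set_integrable_k[of t] k_nonneg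
      by (intro nn_integral_eq_integral) (auto simp: set_integrable_def)
    have "(\<integral>\<^sup>+y. ennreal (2 * exp (- 2 * \<mu> * t)) * ennreal (k y) * indicator {x..} t * of_bool (y \<le> t) \<partial>lborel) =
        (\<integral>\<^sup>+y. (ennreal (2 * exp (- 2 * \<mu> * t)) * indicator {x..} t) * ennreal (indicator {..t} y *\<^sub>R k y) \<partial>lborel)"
      by (intro nn_integral_cong) (simp add: indicator_def)
    also have "\<dots> = (ennreal (2 * exp (- 2 * \<mu> * t)) * indicator {x..} t) * ennreal (K t)"
      unfolding K[symmetric] by (intro nn_integral_cmult) measurable
    also have "\<dots> = ennreal (2 * exp (- 2 * \<mu> * t) * K t) * indicator {x..} t"
      using K_nonneg[of t] by (simp add: ennreal_mult mult_ac)
    finally show "(\<integral>\<^sup>+y. ennreal (2 * exp (- 2 * \<mu> * t)) * ennreal (k y) * indicator {x..} t * of_bool (y \<le> t) \<partial>lborel) =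
        ennreal (2 * exp (- 2 * \<mu> * t) * K t) * indicator {x..} t" .
  qed
  finally show ?thesis .
qed

lemma set_integrable_tail: "set_integrable lborel {x..} (\<lambda>t. 2 * exp (- 2 * \<mu> * t) * K t)"
  and psi_tail: "psi x = 1 - (LINT t:{x..}|lborel. 2 * exp (- 2 * \<mu> * t) * K t)"
proof -
  have eq: "(\<integral>\<^sup>+t. ennreal (indicator {x..} t *\<^sub>R (2 * exp (- 2 * \<mu> * t) * K t)) \<partial>lborel) = ennreal (1 - psi x)"
    unfolding nn_integral_psi_tail by (intro nn_integral_cong) (auto simp: indicator_def)
  show si: "set_integrable lborel {x..} (\<lambda>t. 2 * exp (- 2 * \<mu> * t) * K t)"
    unfolding set_integrable_def
  proof (rule integrableI_nonneg)
    show "(\<integral>\<^sup>+t. ennreal (indicator {x..} t *\<^sub>R (2 * exp (- 2 * \<mu> * t) * K t)) \<partial>lborel) < \<infinity>"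
      unfolding eq by simp
  qed (auto simp: K_nonneg)
  have "ennreal (LINT t:{x..}|lborel. 2 * exp (- 2 * \<mu> * t) * K t) = ennreal (1 - psi x)"
    unfolding set_lebesgue_integral_def eq[symmetric] using si K_nonneg
    by (intro nn_integral_eq_integral[symmetric]) (auto simp: set_integrable_def)
  moreover have "0 \<le> (LINT t:{x..}|lborel. 2 * exp (- 2 * \<mu> * t) * K t)"
    unfolding set_lebesgue_integral_def using K_nonneg by (intro integral_nonneg_AE) auto
  ultimately show "psi x = 1 - (LINT t:{x..}|lborel. 2 * exp (- 2 * \<mu> * t) * K t)"
    using psi_bounds[of x] by simp
qed

text \<open>\<open>K\<close> is continuous even where \<open>f\<close> jumps, so this derivative
  exists and is continuous on the whole line.\<close>

lemma DERIV_psi: "(psi has_real_derivative 2 * exp (- 2 * \<mu> * x) * K x) (at x)"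
proof -
  have "((\<lambda>u. 1 - (LINT t:{u..}|lborel. 2 * exp (- 2 * \<mu> * t) * K t)) has_real_derivative
      0 - (- (2 * exp (- 2 * \<mu> * x) * K x))) (at x)"
    by (intro DERIV_diff DERIV_const DERIV_set_integral_atLeast set_integrable_tail continuous_on_K_exp)
  moreover have "(\<lambda>u. 1 - (LINT t:{u..}|lborel. 2 * exp (- 2 * \<mu> * t) * K t)) = psi"
    by (rule ext) (rule psi_tail[symmetric])
  ultimately show ?thesis by simp
qed

text \<open>The discount is positive wherever \<open>A\<close> is finite, hence almost surely, so
  its expectation cannot vanish.\<close>

lemma psi_pos: "0 < psi x"
proof (rule ccontr)
  assume "\<not> 0 < psi x"
  then have "psi x = 0" using psi_bounds[of x] by simp
  then have "(\<integral>\<^sup>+\<omega>. exp_neg (\<gamma> * A x \<omega>) \<partial>M) = 0"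
    by (simp add: nn_integral_exp_neg_A)
  then have "AE \<omega> in M. ennreal (exp_neg (\<gamma> * A x \<omega>)) = 0"
    by (subst (asm) nn_integral_0_iff_AE) measurable
  then have "AE \<omega> in M. False"
    using AE_A_finite[of x]
  proof eventually_elim
    fix \<omega> assume *: "ennreal (exp_neg (\<gamma> * A x \<omega>)) = 0" "A x \<omega> < \<infinity>"
    then have "ennreal \<gamma> * A x \<omega> < \<infinity>" by (simp add: ennreal_mult_less_top)
    then show False using *(1) by (simp add: exp_neg_def split: if_splits)
  qed
  then show False by simp
qed

lemma solves_psi: "solves_problem \<mu> \<gamma> f psi"
  unfolding solves_problem_def
proof (intro conjI allI impI)
  show "psi C1_differentiable_on UNIV"
    unfolding C1_differentiable_on_def using DERIV_psi continuous_on_K_exp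
    by (auto simp: has_real_derivative_iff_has_vector_derivative intro!: exI[of _ "\<lambda>x. 2 * exp (- 2 * \<mu> * x) * K x"])
  show "(psi \<longlongrightarrow> 1) at_top" by (rule psi_tendsto_1)
  have deriv: "deriv psi = (\<lambda>x. 2 * exp (- 2 * \<mu> * x) * K x)"
    using DERIV_psi by (auto intro!: DERIV_imp_deriv)
  fix x assume "isCont f x"
  then have "isCont k x"
    unfolding k_def using DERIV_isCont[OF DERIV_psi, of x] by (intro continuous_intros)
  then have "(K has_real_derivative k x) (at x)"
    unfolding K_def by (rule DERIV_set_integral_atMost[OF set_integrable_k])
  then have D: "(deriv psi has_real_derivative
      - 4 * \<mu> * exp (- 2 * \<mu> * x) * K x + 2 * exp (- 2 * \<mu> * x) * k x) (at x)"
    unfolding deriv by (auto intro!: derivative_eq_intros simp: algebra_simps)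
  then show "deriv psi field_differentiable at x"
    by (auto simp: field_differentiable_def)
  \<comment> \<open>The drift term cancels the part of the second derivative that contains
    \<open>K\<close>; the factor left over undoes the exponential weight in
    \<open>k\<close>.\<close>
  have "1 / 2 * deriv (deriv psi) x + \<mu> * deriv psi x = exp (- 2 * \<mu> * x) * k x"
    unfolding DERIV_imp_deriv[OF D] by (simp add: deriv field_simps)
  also have "\<dots> = \<gamma> * f x * psi x"
    by (simp add: k_def mult.assoc[symmetric] flip: exp_add)
  finally show "1 / 2 * deriv (deriv psi) x + \<mu> * deriv psi x - \<gamma> * f x * psi x = 0"
    by simp
qed

lemma admissible_psi: "admissible psi"
  unfolding admissible_def
proof (intro conjI allI psi_pos solves_psi monoI)
  fix x y :: real assume "x \<le> y"
  then show "psi x \<le> psi y"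
    using DERIV_psi K_nonneg by (intro DERIV_nonneg_imp_nondecreasing[of x y psi]) (auto intro!: exI)
qed

end

theorem proposition4p3:
  fixes M :: "'a measure" and B :: "real \<Rightarrow> 'a \<Rightarrow> real"
    and \<mu> \<gamma> :: real and f :: "real \<Rightarrow> real"
  assumes "standard_brownian_motion M B"
    and "\<mu> > 0" and "\<gamma> > 0"
    and "\<forall>x. f x \<ge> 0"
    and "piecewise_continuous f"
    and "integrable_near_infinity f"
  shows "((\<forall>x. Psi M B \<mu> \<gamma> f x > 0) \<and> mono (Psi M B \<mu> \<gamma> f) \<and>
          solves_problem \<mu> \<gamma> f (Psi M B \<mu> \<gamma> f)) \<and>
    (\<forall>v. (\<forall>x. v x > 0) \<and> mono v \<and> solves_problem \<mu> \<gamma> f v \<longrightarrow> v = Psi M B \<mu> \<gamma> f)"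
proof -
  interpret standard_brownian_motion M B by fact
  interpret piecewise_perpetual M B \<mu> \<gamma> f
    by unfold_locales (use assms piecewise_continuous_measurable in auto)
  show ?thesis
    using admissible_psi admissible_unique[OF _ admissible_psi] unfolding admissible_def by blast
qed

end
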